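(* Let $X$ be a first-countable, timelike path-connected, geodesic, causally simple Lorentzian pre-length space, or a metric-compatible KS-Lorentzian pre-length space with these properties, with a finite, continuous Lorentzian distance, compact causal diamonds, and empty bubbling boundary. If there exists a Cauchy complete timelike curve through every point of $X$, then the extended metric space $(\mathcal{C}_X^w,d_J)$ is complete. In particular, if $X$ satisfies Condition B, then $(\mathcal{C}_X,d_J)=(\mathcal{C}^w_X,d_J)$ is complete.
   Context: An extended time separation function on a set $X$ is a map $\ell:X\times X\to\{-\infty\}\cup[0,\infty]$ with $\ell(x,x)\ge0$ and $\ell(x,y)+\ell(y,z)\le\ell(x,z)$ (convention $-\infty+\infty=-\infty$). Put $d=\max(0,\ell)$ (Lorentzian distance); $x\le y$ iff $\ell(x,y)\ge0$; $x\ll y$ iff $d(x,y)>0$; $J^+(x)=\{y:x\le y\}$, $J^-(x)=\{y:y\le x\}$, $I^+(x)=\{y:x\ll y\}$, $I^-(x)=\{y:y\ll x\}$. A Lorentzian pre-length space is such a pair with a topology for which all $I^\pm(x)$ are open. Causally simple: $\le$ is antisymmetric and all $J^\pm(x)$ are closed. Causal diamonds are the sets $J^+(x)\cap J^-(y)$. The bubbling boundary is empty if $\{x:J^+(x)=\{x\}\}=\{x:I^+(x)=\emptyset\}$ and $\{x:J^-(x)=\{x\}\}=\{x:I^-(x)=\emptyset\}$. Curves are continuous maps from (possibly degenerate) intervals $I\subset\mathbb{R}$. A curve $\gamma$ is causal if $t<s$ implies $\gamma(t)\le\gamma(s)$ and $\gamma$ is not constant on any nondegenerate subinterval; timelike if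 $t<s$ implies $\gamma(t)\ll\gamma(s)$. Timelike path-connected: any $x\ll y$ can be connected by a timelike curve. $L(\gamma)=\inf\sum_i d(\gamma(t_i),\gamma(t_{i+1}))$ over partitions of $[a,b]$. Geodesic: for all $x\le y$ there is a causal curve $\gamma$ from $x$ to $y$ with $L(\gamma)=d(x,y)$. A KS-Lorentzian pre-length space is a Lorentzian pre-length space with a metric $\rho$ inducing its topology such that $d$ is lower semicontinuous; in this setting all curves, and all notions defined via curves, are in terms of curves locally Lipschitz with respect to $\rho$. It is metric-compatible if every $x$ has a neighborhood $U$ and a $C>0$ such that every causal curve contained in $U$ has $\rho$-arclength at most $C$. A causal curve $\gamma:I\to X$ is future extendible if there exist an order-preserving homeomorphism $\varphi:I\to\hat I$ onto an interval, an interval $\tilde I\supset\hat I$ containing some $t$ with $t>s$ for all $s\in\hat I$, and a causal curve $\tilde\gamma:\tilde I\to X$ with $\tilde\gamma|_{\hat I}=\gamma\circ\varphi^{-1}$; otherwise future inextendible. Past versions are analogous; inextendible means both. A timelike curve is (future, past) inextendible if it is so as a causal curve. A future inextendible timelike curve $\gamma:I\to X$ is future Cauchy complete if: whenever $d(\gamma(t_0),\gamma(\cdot))$ is bounded on $[t_0,\infty)\cap I$ for some $t_0\in I$, then $\sup I\in I$; past Cauchy completeness of past inextendible timelike curves is defined analogously. Cauchy complete: inextendible and future and past Cauchy complete. Condition B: every future (past) inextendible timelike curve is future (past) Cauchy complete. $\mathcal{C}_X$ (resp. $\mathcal{C}^w_X$) is the set of subsets of $X$ that are intersected exactly once by every inextendible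 (resp. Cauchy complete) timelike curve. $d_J(A,B)=\sup_{x\in A,y\in B}(d(x,y)+d(y,x))$. An extended metric is a metric that may take the value $\infty$. *)

theory Defs
  imports "HOL-Analysis.Analysis"
begin

text \<open>
  The set \<open>X\<close> is the universe of a type of class \<open>topological_space\<close>. The library sum on \<open>ereal\<close>
  has \<open>\<infinity> + - \<infinity> = \<infinity>\<close>; the reverse triangle inequality uses the opposite convention.
\<close>

definition plus_lower :: "ereal \<Rightarrow> ereal \<Rightarrow> ereal" where
  "plus_lower a b = (if a = - \<infinity> \<or> b = - \<infinity> then - \<infinity> else a + b)"

definition time_separation :: "('a \<Rightarrow> 'a \<Rightarrow> ereal) \<Rightarrow> bool" where
  "time_separation l \<longleftrightarrow>
     (\<forall>x y. l x y = - \<infinity> \<or> 0 \<le> l x y) \<and>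
     (\<forall>x. 0 \<le> l x x) \<and>
     (\<forall>x y z. plus_lower (l x y) (l y z) \<le> l x z)"

definition ldist :: "('a \<Rightarrow> 'a \<Rightarrow> ereal) \<Rightarrow> 'a \<Rightarrow> 'a \<Rightarrow> ereal" where
  "ldist l x y = max 0 (l x y)"

definition causal_le :: "('a \<Rightarrow> 'a \<Rightarrow> ereal) \<Rightarrow> 'a \<Rightarrow> 'a \<Rightarrow> bool" where
  "causal_le l x y \<longleftrightarrow> 0 \<le> l x y"

definition chron_less :: "('a \<Rightarrow> 'a \<Rightarrow> ereal) \<Rightarrow> 'a \<Rightarrow> 'a \<Rightarrow> bool" where
  "chron_less l x y \<longleftrightarrow> 0 < ldist l x y"

definition J_future :: "('a \<Rightarrow> 'a \<Rightarrow> ereal) \<Rightarrow> 'a \<Rightarrow> 'a set" where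
  "J_future l x = {y. causal_le l x y}"

definition J_past :: "('a \<Rightarrow> 'a \<Rightarrow> ereal) \<Rightarrow> 'a \<Rightarrow> 'a set" where
  "J_past l x = {y. causal_le l y x}"

definition I_future :: "('a \<Rightarrow> 'a \<Rightarrow> ereal) \<Rightarrow> 'a \<Rightarrow> 'a set" where
  "I_future l x = {y. chron_less l x y}"

definition I_past :: "('a \<Rightarrow> 'a \<Rightarrow> ereal) \<Rightarrow> 'a \<Rightarrow> 'a set" where
  "I_past l x = {y. chron_less l y x}"

definition lorentzian_prelength_space :: "('a::topological_space \<Rightarrow> 'a \<Rightarrow> ereal) \<Rightarrow> bool" where
  "lorentzian_prelength_space l \<longleftrightarrow>
     time_separation l \<and> (\<forall>x. open (I_future l x) \<and> open (I_past l x))"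

definition causally_simple :: "('a::topological_space \<Rightarrow> 'a \<Rightarrow> ereal) \<Rightarrow> bool" where
  "causally_simple l \<longleftrightarrow>
     (\<forall>x y. causal_le l x y \<and> causal_le l y x \<longrightarrow> x = y) \<and>
     (\<forall>x. closed (J_future l x) \<and> closed (J_past l x))"

definition finite_ldist :: "('a \<Rightarrow> 'a \<Rightarrow> ereal) \<Rightarrow> bool" where
  "finite_ldist l \<longleftrightarrow> (\<forall>x y. ldist l x y < \<infinity>)"

definition continuous_ldist :: "('a::topological_space \<Rightarrow> 'a \<Rightarrow> ereal) \<Rightarrow> bool" where
  "continuous_ldist l \<longleftrightarrow> continuous_on UNIV (\<lambda>(x, y). ldist l x y)"

definition compact_diamonds :: "('a::topological_space \<Rightarrow> 'a \<Rightarrow> ereal) \<Rightarrow> bool" where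
  "compact_diamonds l \<longleftrightarrow> (\<forall>x y. compact (J_future l x \<inter> J_past l y))"

definition empty_bubbling_boundary :: "('a \<Rightarrow> 'a \<Rightarrow> ereal) \<Rightarrow> bool" where
  "empty_bubbling_boundary l \<longleftrightarrow>
     {x. J_future l x = {x}} = {x. I_future l x = {}} \<and>
     {x. J_past l x = {x}} = {x. I_past l x = {}}"

text \<open>
  A curve is a pair of a domain \<open>I\<close>, a nonempty and possibly degenerate interval, and a function
  of which only the values on \<open>I\<close> matter. All notions that involve curves take the admissible
  class of curves as a parameter \<open>crv\<close>: either all continuous curves, or the curves that are locally
  Lipschitz for a given metric.
\<close>

type_synonym 'a curve_class = "real set \<Rightarrow> (real \<Rightarrow> 'a) \<Rightarrow> bool"

definition continuous_curve :: "'a::topological_space curve_class" where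
  "continuous_curve I \<gamma> \<longleftrightarrow> is_interval I \<and> I \<noteq> {} \<and> continuous_on I \<gamma>"

definition lipschitz_curve :: "'a::topological_space metric \<Rightarrow> 'a curve_class" where
  "lipschitz_curve \<rho> I \<gamma> \<longleftrightarrow> continuous_curve I \<gamma> \<and>
     (\<forall>t\<in>I. \<exists>\<epsilon>>0. Lipschitz_continuous_map (submetric euclidean_metric (I \<inter> ball t \<epsilon>)) \<rho> \<gamma>)"

definition causal_curve :: "('a \<Rightarrow> 'a \<Rightarrow> ereal) \<Rightarrow> 'a curve_class \<Rightarrow> 'a curve_class" where
  "causal_curve l crv I \<gamma> \<longleftrightarrow> crv I \<gamma> \<and>
     (\<forall>t\<in>I. \<forall>s\<in>I. t < s \<longrightarrow> causal_le l (\<gamma> t) (\<gamma> s)) \<and>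
     (\<forall>a\<in>I. \<forall>b\<in>I. a < b \<longrightarrow> \<not> \<gamma> constant_on {a..b})"

definition timelike_curve :: "('a \<Rightarrow> 'a \<Rightarrow> ereal) \<Rightarrow> 'a curve_class \<Rightarrow> 'a curve_class" where
  "timelike_curve l crv I \<gamma> \<longleftrightarrow> crv I \<gamma> \<and>
     (\<forall>t\<in>I. \<forall>s\<in>I. t < s \<longrightarrow> chron_less l (\<gamma> t) (\<gamma> s))"

definition timelike_path_connected ::
  "('a \<Rightarrow> 'a \<Rightarrow> ereal) \<Rightarrow> 'a curve_class \<Rightarrow> bool" where
  "timelike_path_connected l crv \<longleftrightarrow>
     (\<forall>x y. chron_less l x y \<longrightarrow>
        (\<exists>a b \<gamma>. a \<le> b \<and> timelike_curve l crv {a..b} \<gamma> \<and> \<gamma> a = x \<and> \<gamma> b = y))"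

text \<open>
  A pair \<open>(n, t)\<close> stands for the sequence \<open>t 0 < \<dots> < t n\<close>; the values of \<open>t\<close> beyond \<open>n\<close> are
  irrelevant. A degenerate interval has the partition with \<open>n = 0\<close>.
\<close>

definition chains :: "real set \<Rightarrow> (nat \<times> (nat \<Rightarrow> real)) set" where
  "chains I = {(n, t). (\<forall>i\<le>n. t i \<in> I) \<and> (\<forall>i<n. t i < t (Suc i))}"

definition partitions :: "real \<Rightarrow> real \<Rightarrow> (nat \<times> (nat \<Rightarrow> real)) set" where
  "partitions a b = {(n, t). (n, t) \<in> chains {a..b} \<and> t 0 = a \<and> t n = b}"

definition lorentz_length ::
  "('a \<Rightarrow> 'a \<Rightarrow> ereal) \<Rightarrow> real \<Rightarrow> real \<Rightarrow> (real \<Rightarrow> 'a) \<Rightarrow> ereal" where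
  "lorentz_length l a b \<gamma> =
     (INF (n, t)\<in>partitions a b. \<Sum>i<n. ldist l (\<gamma> (t i)) (\<gamma> (t (Suc i))))"

definition geodesic_space :: "('a \<Rightarrow> 'a \<Rightarrow> ereal) \<Rightarrow> 'a curve_class \<Rightarrow> bool" where
  "geodesic_space l crv \<longleftrightarrow>
     (\<forall>x y. causal_le l x y \<longrightarrow>
        (\<exists>a b \<gamma>. a \<le> b \<and> causal_curve l crv {a..b} \<gamma> \<and> \<gamma> a = x \<and> \<gamma> b = y \<and>
           lorentz_length l a b \<gamma> = ldist l x y))"

definition KS_prelength_space ::
  "('a::topological_space \<Rightarrow> 'a \<Rightarrow> ereal) \<Rightarrow> 'a metric \<Rightarrow> bool" where
  "KS_prelength_space l \<rho> \<longleftrightarrow>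
     lorentzian_prelength_space l \<and>
     mspace \<rho> = UNIV \<and> mtopology_of \<rho> = euclidean \<and>
     (\<forall>c. open {(x, y). c < ldist l x y})"

definition arclength :: "'a metric \<Rightarrow> real set \<Rightarrow> (real \<Rightarrow> 'a) \<Rightarrow> ereal" where
  "arclength \<rho> I \<gamma> =
     (SUP (n, t)\<in>chains I. ereal (\<Sum>i<n. mdist \<rho> (\<gamma> (t i)) (\<gamma> (t (Suc i)))))"

definition metric_compatible ::
  "('a::topological_space \<Rightarrow> 'a \<Rightarrow> ereal) \<Rightarrow> 'a metric \<Rightarrow> bool" where
  "metric_compatible l \<rho> \<longleftrightarrow>
     (\<forall>x. \<exists>U C. x \<in> interior U \<and> 0 < C \<and>
        (\<forall>I \<gamma>. causal_curve l (lipschitz_curve \<rho>) I \<gamma> \<and> \<gamma> ` I \<subseteq> U \<longrightarrow>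
           arclength \<rho> I \<gamma> \<le> ereal C))"

definition future_extendible ::
  "('a \<Rightarrow> 'a \<Rightarrow> ereal) \<Rightarrow> 'a curve_class \<Rightarrow> 'a curve_class" where
  "future_extendible l crv I \<gamma> \<longleftrightarrow>
     (\<exists>\<phi> \<psi> I' I'' \<gamma>'. is_interval I' \<and> homeomorphism I I' \<phi> \<psi> \<and> strict_mono_on I \<phi> \<and>
        is_interval I'' \<and> I' \<subseteq> I'' \<and> (\<exists>t\<in>I''. \<forall>s\<in>I'. s < t) \<and>
        causal_curve l crv I'' \<gamma>' \<and> (\<forall>s\<in>I'. \<gamma>' s = \<gamma> (\<psi> s)))"

definition past_extendible ::
  "('a \<Rightarrow> 'a \<Rightarrow> ereal) \<Rightarrow> 'a curve_class \<Rightarrow> 'a curve_class" where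
  "past_extendible l crv I \<gamma> \<longleftrightarrow>
     (\<exists>\<phi> \<psi> I' I'' \<gamma>'. is_interval I' \<and> homeomorphism I I' \<phi> \<psi> \<and> strict_mono_on I \<phi> \<and>
        is_interval I'' \<and> I' \<subseteq> I'' \<and> (\<exists>t\<in>I''. \<forall>s\<in>I'. t < s) \<and>
        causal_curve l crv I'' \<gamma>' \<and> (\<forall>s\<in>I'. \<gamma>' s = \<gamma> (\<psi> s)))"

definition future_inextendible_timelike ::
  "('a \<Rightarrow> 'a \<Rightarrow> ereal) \<Rightarrow> 'a curve_class \<Rightarrow> 'a curve_class" where
  "future_inextendible_timelike l crv I \<gamma> \<longleftrightarrow>
     timelike_curve l crv I \<gamma> \<and> \<not> future_extendible l crv I \<gamma>"

definition past_inextendible_timelike ::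
  "('a \<Rightarrow> 'a \<Rightarrow> ereal) \<Rightarrow> 'a curve_class \<Rightarrow> 'a curve_class" where
  "past_inextendible_timelike l crv I \<gamma> \<longleftrightarrow>
     timelike_curve l crv I \<gamma> \<and> \<not> past_extendible l crv I \<gamma>"

definition inextendible_timelike ::
  "('a \<Rightarrow> 'a \<Rightarrow> ereal) \<Rightarrow> 'a curve_class \<Rightarrow> 'a curve_class" where
  "inextendible_timelike l crv I \<gamma> \<longleftrightarrow>
     future_inextendible_timelike l crv I \<gamma> \<and> past_inextendible_timelike l crv I \<gamma>"

text \<open>
  The supremum of \<open>I\<close> is taken in the extended reals, whence the boundedness conjunct: \<open>Sup I\<close> in
  the type \<open>real\<close> is unspecified for unbounded \<open>I\<close>.
\<close>

definition future_cauchy_complete ::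
  "('a \<Rightarrow> 'a \<Rightarrow> ereal) \<Rightarrow> 'a curve_class \<Rightarrow> 'a curve_class" where
  "future_cauchy_complete l crv I \<gamma> \<longleftrightarrow> future_inextendible_timelike l crv I \<gamma> \<and>
     ((\<exists>t0\<in>I. \<exists>C::real. \<forall>t \<in> {t0..} \<inter> I. ldist l (\<gamma> t0) (\<gamma> t) \<le> ereal C)
        \<longrightarrow> bdd_above I \<and> Sup I \<in> I)"

definition past_cauchy_complete ::
  "('a \<Rightarrow> 'a \<Rightarrow> ereal) \<Rightarrow> 'a curve_class \<Rightarrow> 'a curve_class" where
  "past_cauchy_complete l crv I \<gamma> \<longleftrightarrow> past_inextendible_timelike l crv I \<gamma> \<and>
     ((\<exists>t0\<in>I. \<exists>C::real. \<forall>t \<in> {..t0} \<inter> I. ldist l (\<gamma> t) (\<gamma> t0) \<le> ereal C)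
        \<longrightarrow> bdd_below I \<and> Inf I \<in> I)"

definition cauchy_complete_timelike ::
  "('a \<Rightarrow> 'a \<Rightarrow> ereal) \<Rightarrow> 'a curve_class \<Rightarrow> 'a curve_class" where
  "cauchy_complete_timelike l crv I \<gamma> \<longleftrightarrow>
     inextendible_timelike l crv I \<gamma> \<and>
     future_cauchy_complete l crv I \<gamma> \<and> past_cauchy_complete l crv I \<gamma>"

definition condition_B :: "('a \<Rightarrow> 'a \<Rightarrow> ereal) \<Rightarrow> 'a curve_class \<Rightarrow> bool" where
  "condition_B l crv \<longleftrightarrow>
     (\<forall>I \<gamma>. future_inextendible_timelike l crv I \<gamma> \<longrightarrow> future_cauchy_complete l crv I \<gamma>) \<and>
     (\<forall>I \<gamma>. past_inextendible_timelike l crv I \<gamma> \<longrightarrow> past_cauchy_complete l crv I \<gamma>)"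

definition cauchy_sets :: "('a \<Rightarrow> 'a \<Rightarrow> ereal) \<Rightarrow> 'a curve_class \<Rightarrow> 'a set set" where
  "cauchy_sets l crv =
     {A. \<forall>I \<gamma>. inextendible_timelike l crv I \<gamma> \<longrightarrow> (\<exists>!t. t \<in> I \<and> \<gamma> t \<in> A)}"

definition weak_cauchy_sets :: "('a \<Rightarrow> 'a \<Rightarrow> ereal) \<Rightarrow> 'a curve_class \<Rightarrow> 'a set set" where
  "weak_cauchy_sets l crv =
     {A. \<forall>I \<gamma>. cauchy_complete_timelike l crv I \<gamma> \<longrightarrow> (\<exists>!t. t \<in> I \<and> \<gamma> t \<in> A)}"

definition d_J :: "('a \<Rightarrow> 'a \<Rightarrow> ereal) \<Rightarrow> 'a set \<Rightarrow> 'a set \<Rightarrow> ereal" where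
  "d_J l A B = (SUP (x, y)\<in>A \<times> B. ldist l x y + ldist l y x)"

definition extended_metric_on :: "'b set \<Rightarrow> ('b \<Rightarrow> 'b \<Rightarrow> ereal) \<Rightarrow> bool" where
  "extended_metric_on S D \<longleftrightarrow>
     (\<forall>x\<in>S. \<forall>y\<in>S. 0 \<le> D x y \<and> D x y = D y x \<and> (D x y = 0 \<longleftrightarrow> x = y)) \<and>
     (\<forall>x\<in>S. \<forall>y\<in>S. \<forall>z\<in>S. D x z \<le> D x y + D y z)"

definition complete_extended_metric :: "'b set \<Rightarrow> ('b \<Rightarrow> 'b \<Rightarrow> ereal) \<Rightarrow> bool" where
  "complete_extended_metric S D \<longleftrightarrow> extended_metric_on S D \<and>
     (\<forall>A :: nat \<Rightarrow> 'b. range A \<subseteq> S \<and>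
          (\<forall>\<epsilon>>0. \<exists>N. \<forall>m\<ge>N. \<forall>n\<ge>N. D (A m) (A n) < \<epsilon>) \<longrightarrow>
        (\<exists>B\<in>S. (\<lambda>n. D (A n) B) \<longlonglongrightarrow> 0))"

end

theory Submission
  imports Defs
begin

text \<open>
  Each of the two notions of curve is closed under restriction, concatenation and affine
  reparametrisation, and only this is used of it. A Cauchy complete past half-curve, a timelike
  segment and a Cauchy complete future half-curve join to a Cauchy complete timelike curve, so any
  two points with \<open>x \<lless> y\<close> lie on one; hence weak Cauchy sets are achronal. Such a set \<open>B\<close>
  therefore divides the space into the disjoint parts \<open>I\<^sup>-(B)\<close>, \<open>B\<close>, \<open>I\<^sup>+(B)\<close>, of which the
  outer two are open, and a maximising causal curve from \<open>I\<^sup>-(B)\<close> to \<open>I\<^sup>+(B)\<close>, being connected,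
  meets \<open>B\<close>. This gives the triangle inequality.

  For completeness, let \<open>A\<^sub>n\<close> be a Cauchy sequence. On a Cauchy complete timelike curve the
  intersection parameters with \<open>A\<^sub>n\<close> stay in a compact interval, since otherwise the distances
  along the curve would be unbounded, and they form a Cauchy sequence, since the distance is bounded
  away from 0 on parameters that are not close. The set of all limits of sequences \<open>x\<^sub>n \<in> A\<^sub>n\<close> is
  the limit of \<open>A\<^sub>n\<close>.

  Under Condition B only the existence of inextendible timelike curves through each point is missing;
  these are obtained by a greedy construction, which uses the finiteness of the distance and the empty
  bubbling boundary.
\<close>

section \<open>Admissible curves\<close>

text \<open>The slope in \<open>crv_affine\<close> may be negative, so that time reversal is
  included. \<open>crv_ray\<close> turns the finite concatenations that \<open>crv_glue\<close>
  provides into countable ones; this serves for curves that run through infinitely many prescribed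
  points.\<close>

locale admissible_curves =
  fixes crv :: "'a::topological_space curve_class"
  assumes crv_continuous_curve: "crv I \<gamma> \<Longrightarrow> continuous_curve I \<gamma>"
    and crv_subset: "crv I \<gamma> \<Longrightarrow> J \<subseteq> I \<Longrightarrow> is_interval J \<Longrightarrow> J \<noteq> {} \<Longrightarrow> crv J \<gamma>"
    and crv_glue: "is_interval I \<Longrightarrow> c \<in> I \<Longrightarrow> crv (I \<inter> {..c}) \<gamma> \<Longrightarrow> crv (I \<inter> {c..}) \<gamma> \<Longrightarrow> crv I \<gamma>"
    and crv_affine: "m \<noteq> 0 \<Longrightarrow> crv I \<gamma> \<Longrightarrow> crv ((\<lambda>t. m * t + c) -` I) (\<lambda>t. \<gamma> (m * t + c))"
    and crv_sing: "crv {a} \<gamma>"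
    and crv_cong: "crv I \<gamma> \<Longrightarrow> (\<And>t. t \<in> I \<Longrightarrow> \<gamma> t = \<gamma>' t) \<Longrightarrow> crv I \<gamma>'"
    and crv_ray: "(\<And>n. crv {0..real n} \<gamma>) \<Longrightarrow> crv {0..} \<gamma>"

section \<open>Continuous curves\<close>

lemma is_interval_affine_vimage:
  fixes I :: "real set"
  assumes "m \<noteq> 0" "is_interval I"
  shows "is_interval ((\<lambda>t. m * t + c) -` I)"
  unfolding is_interval_1
proof (intro ballI allI impI)
  fix a b x assume ab: "a \<in> (\<lambda>t. m * t + c) -` I" "b \<in> (\<lambda>t. m * t + c) -` I" "a \<le> x \<and> x \<le> b"
  show "x \<in> (\<lambda>t. m * t + c) -` I"
  proof (cases "m > 0")
    case True
    then have "m * a + c \<le> m * x + c" "m * x + c \<le> m * b + c" using ab by auto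
    then show ?thesis using ab assms(2) unfolding is_interval_1 by blast
  next
    case False
    then have "m * b + c \<le> m * x + c" "m * x + c \<le> m * a + c" using ab by (auto intro: mult_left_mono_neg)
    then show ?thesis using ab assms(2) unfolding is_interval_1 by blast
  qed
qed

lemma continuous_curve_subset:
  "continuous_curve I \<gamma> \<Longrightarrow> J \<subseteq> I \<Longrightarrow> is_interval J \<Longrightarrow> J \<noteq> {} \<Longrightarrow> continuous_curve J \<gamma>"
  by (auto simp: continuous_curve_def intro: continuous_on_subset)

lemma continuous_curve_glue:
  assumes "is_interval I" "c \<in> I" "continuous_curve (I \<inter> {..c}) \<gamma>" "continuous_curve (I \<inter> {c..}) \<gamma>"
  shows "continuous_curve I \<gamma>"
proof -
  have I: "I = (I \<inter> {..c}) \<union> (I \<inter> {c..})" by auto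
  have "continuous_on ((I \<inter> {..c}) \<union> (I \<inter> {c..})) \<gamma>"
    by (rule continuous_on_Un_local) (use assms I in \<open>auto simp: continuous_curve_def closedin_closed_Int\<close>)
  then show ?thesis using I assms by (auto simp: continuous_curve_def)
qed

lemma continuous_curve_affine:
  assumes "m \<noteq> 0" "continuous_curve I \<gamma>"
  shows "continuous_curve ((\<lambda>t. m * t + c) -` I) (\<lambda>t. \<gamma> (m * t + c))"
proof -
  obtain a where "a \<in> I" using assms by (auto simp: continuous_curve_def)
  then have "(a - c) / m \<in> (\<lambda>t. m * t + c) -` I" using assms(1) by simp
  moreover have "continuous_on ((\<lambda>t. m * t + c) -` I) (\<lambda>t. \<gamma> (m * t + c))"
    by (rule continuous_on_compose2[of I]) (use assms in \<open>auto simp: continuous_curve_def intro!: continuous_intros\<close>)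
  ultimately show ?thesis
    using assms is_interval_affine_vimage unfolding continuous_curve_def by blast
qed

lemma continuous_curve_sing: "continuous_curve {a} \<gamma>"
  by (auto simp: continuous_curve_def is_interval_1)

lemma continuous_curve_cong:
  assumes "continuous_curve I \<gamma>" "\<And>t. t \<in> I \<Longrightarrow> \<gamma> t = \<gamma>' t"
  shows "continuous_curve I \<gamma>'"
  using assms continuous_on_cong[of I I \<gamma> \<gamma>'] by (auto simp: continuous_curve_def)

lemma continuous_curve_ray:
  fixes \<gamma> :: "real \<Rightarrow> 'a::topological_space"
  assumes "\<And>n. continuous_curve {0..real n} \<gamma>"
  shows "continuous_curve {0..} \<gamma>"
proof -
  have "continuous (at x within {0..}) \<gamma>" if x: "x \<ge> 0" for x
  proof -
    obtain n where n: "x < real n" using reals_Archimedean2 by blast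
    have "continuous (at x within {0..real n}) \<gamma>"
      using assms[of n] x n by (auto simp: continuous_curve_def continuous_on_eq_continuous_within)
    moreover have "at x within {0..real n} = at x within {0..}"
      by (rule at_within_nhd[of _ "{..<real n}"]) (use n in auto)
    ultimately show ?thesis by simp
  qed
  then show ?thesis
    by (auto simp: continuous_curve_def continuous_on_eq_continuous_within is_interval_ci)
qed

lemma admissible_curves_continuous: "admissible_curves continuous_curve"
  by (rule admissible_curves.intro)
    (assumption | rule continuous_curve_subset continuous_curve_glue continuous_curve_affine
        continuous_curve_sing continuous_curve_cong continuous_curve_ray; assumption)+

section \<open>Curves that are locally Lipschitz for a metric\<close>

text \<open>With carrier \<open>UNIV\<close> the maps into \<open>\<rho>\<close> have no membership
  condition left, and the Lipschitz constant can be taken positive. This turns the closure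
  properties into estimates on \<open>mdist\<close>.\<close>

lemma lipschitz_curve_iff:
  assumes "mspace \<rho> = UNIV"
  shows "lipschitz_curve \<rho> I \<gamma> \<longleftrightarrow> continuous_curve I \<gamma> \<and>
    (\<forall>t\<in>I. \<exists>\<epsilon>>0. \<exists>B>0. \<forall>x\<in>I \<inter> ball t \<epsilon>. \<forall>y\<in>I \<inter> ball t \<epsilon>. mdist \<rho> (\<gamma> x) (\<gamma> y) \<le> B * \<bar>x - y\<bar>)"
  unfolding lipschitz_curve_def Lipschitz_continuous_map_pos using assms by (simp add: dist_real_def)

lemma lipschitz_curve_subset:
  assumes "lipschitz_curve \<rho> I \<gamma>" "J \<subseteq> I" "is_interval J" "J \<noteq> {}"
  shows "lipschitz_curve \<rho> J \<gamma>"
  unfolding lipschitz_curve_def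
proof (intro conjI ballI)
  show "continuous_curve J \<gamma>" using assms continuous_curve_subset lipschitz_curve_def by metis
  fix t assume "t \<in> J"
  then obtain \<epsilon> where "\<epsilon> > 0" "Lipschitz_continuous_map (submetric euclidean_metric (I \<inter> ball t \<epsilon>)) \<rho> \<gamma>"
    using assms unfolding lipschitz_curve_def by blast
  then show "\<exists>\<epsilon>>0. Lipschitz_continuous_map (submetric euclidean_metric (J \<inter> ball t \<epsilon>)) \<rho> \<gamma>"
    using Lipschitz_continuous_map_from_submetric_mono[of euclidean_metric "I \<inter> ball t \<epsilon>" \<rho> \<gamma> "J \<inter> ball t \<epsilon>"]
      assms(2) by blast
qed

text \<open>Only the parameter \<open>c\<close> is critical. For \<open>x \<le> c \<le> y\<close>
  the triangle inequality through \<open>\<gamma> c\<close>, together with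
  \<open>\<bar>x - c\<bar> + \<bar>c - y\<bar> = \<bar>x - y\<bar>\<close>, shows that the larger of
  the two one-sided constants works.\<close>

lemma lipschitz_curve_glue:
  assumes \<rho>: "mspace \<rho> = UNIV" and I: "is_interval I" "c \<in> I"
    and L: "lipschitz_curve \<rho> (I \<inter> {..c}) \<gamma>" and R: "lipschitz_curve \<rho> (I \<inter> {c..}) \<gamma>"
  shows "lipschitz_curve \<rho> I \<gamma>"
  unfolding lipschitz_curve_iff[OF \<rho>]
proof (intro conjI ballI)
  show "continuous_curve I \<gamma>"
    using continuous_curve_glue I L R unfolding lipschitz_curve_def by blast
  fix t assume t: "t \<in> I"
  note L' = L[unfolded lipschitz_curve_iff[OF \<rho>], THEN conjunct2, rule_format]
  note R' = R[unfolded lipschitz_curve_iff[OF \<rho>], THEN conjunct2, rule_format]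
  consider "t < c" | "t > c" | "t = c" by linarith
  then show "\<exists>\<epsilon>>0. \<exists>B>0. \<forall>x\<in>I \<inter> ball t \<epsilon>. \<forall>y\<in>I \<inter> ball t \<epsilon>. mdist \<rho> (\<gamma> x) (\<gamma> y) \<le> B * \<bar>x - y\<bar>"
  proof cases
    case 1
    then obtain \<epsilon> B where e: "\<epsilon> > 0" "B > 0" "\<And>x y. x \<in> I \<inter> {..c} \<inter> ball t \<epsilon> \<Longrightarrow>
        y \<in> I \<inter> {..c} \<inter> ball t \<epsilon> \<Longrightarrow> mdist \<rho> (\<gamma> x) (\<gamma> y) \<le> B * \<bar>x - y\<bar>"
      using L'[of t] t by auto
    \<comment> \<open>The radius is at most the distance to \<open>c\<close>, so that the ball does
      not reach into the other half.\<close>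
    show ?thesis
      by (intro exI[of _ "min \<epsilon> (c - t)"] exI[of _ B] conjI ballI e(3))
        (use e 1 in \<open>auto simp: dist_real_def\<close>)
  next
    case 2
    then obtain \<epsilon> B where e: "\<epsilon> > 0" "B > 0" "\<And>x y. x \<in> I \<inter> {c..} \<inter> ball t \<epsilon> \<Longrightarrow>
        y \<in> I \<inter> {c..} \<inter> ball t \<epsilon> \<Longrightarrow> mdist \<rho> (\<gamma> x) (\<gamma> y) \<le> B * \<bar>x - y\<bar>"
      using R'[of t] t by auto
    show ?thesis
      by (intro exI[of _ "min \<epsilon> (t - c)"] exI[of _ B] conjI ballI e(3))
        (use e 2 in \<open>auto simp: dist_real_def\<close>)
  next
    case 3
    obtain \<epsilon> B where e: "\<epsilon> > 0" "B > 0" "\<And>x y. x \<in> I \<inter> {..c} \<inter> ball c \<epsilon> \<Longrightarrow>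
        y \<in> I \<inter> {..c} \<inter> ball c \<epsilon> \<Longrightarrow> mdist \<rho> (\<gamma> x) (\<gamma> y) \<le> B * \<bar>x - y\<bar>"
      using L'[of c] I(2) by auto
    obtain \<epsilon>' B' where e': "\<epsilon>' > 0" "B' > 0" "\<And>x y. x \<in> I \<inter> {c..} \<inter> ball c \<epsilon>' \<Longrightarrow>
        y \<in> I \<inter> {c..} \<inter> ball c \<epsilon>' \<Longrightarrow> mdist \<rho> (\<gamma> x) (\<gamma> y) \<le> B' * \<bar>x - y\<bar>"
      using R'[of c] I(2) by auto
    define \<delta> where "\<delta> = min \<epsilon> \<epsilon>'"
    define C where "C = max B B'"
    have le: "mdist \<rho> (\<gamma> x) (\<gamma> y) \<le> C * \<bar>x - y\<bar>"
      if "x \<in> I \<inter> ball c \<delta>" "y \<in> I \<inter> ball c \<delta>" "x \<le> y" for x y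
    proof -
      have BC: "B * \<bar>u - v\<bar> \<le> C * \<bar>u - v\<bar>" "B' * \<bar>u - v\<bar> \<le> C * \<bar>u - v\<bar>" for u v
        by (auto simp: C_def intro!: mult_right_mono)
      consider "y \<le> c" | "c \<le> x" | "x \<le> c" "c \<le> y" by linarith
      then show ?thesis
      proof cases
        case 1
        then have "mdist \<rho> (\<gamma> x) (\<gamma> y) \<le> B * \<bar>x - y\<bar>" by (intro e(3)) (use that in \<open>auto simp: \<delta>_def\<close>)
        then show ?thesis using BC(1)[of x y] by linarith
      next
        case 2
        then have "mdist \<rho> (\<gamma> x) (\<gamma> y) \<le> B' * \<bar>x - y\<bar>" by (intro e'(3)) (use that in \<open>auto simp: \<delta>_def\<close>)
        then show ?thesis using BC(2)[of x y] by linarith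
      next
        case 3
        have "mdist \<rho> (\<gamma> x) (\<gamma> c) \<le> B * \<bar>x - c\<bar>"
          by (intro e(3)) (use that 3 I e in \<open>auto simp: \<delta>_def\<close>)
        moreover have "mdist \<rho> (\<gamma> c) (\<gamma> y) \<le> B' * \<bar>c - y\<bar>"
          by (intro e'(3)) (use that 3 I e' in \<open>auto simp: \<delta>_def\<close>)
        moreover have "mdist \<rho> (\<gamma> x) (\<gamma> y) \<le> mdist \<rho> (\<gamma> x) (\<gamma> c) + mdist \<rho> (\<gamma> c) (\<gamma> y)"
          using mdist_triangle \<rho> by (metis UNIV_I)
        ultimately have "mdist \<rho> (\<gamma> x) (\<gamma> y) \<le> C * \<bar>x - c\<bar> + C * \<bar>c - y\<bar>"
          using BC(1)[of x c] BC(2)[of c y] by linarith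
        also have "\<dots> = C * \<bar>x - y\<bar>" using 3 by (simp add: algebra_simps)
        finally show ?thesis .
      qed
    qed
    have "mdist \<rho> (\<gamma> x) (\<gamma> y) \<le> C * \<bar>x - y\<bar>"
      if "x \<in> I \<inter> ball c \<delta>" "y \<in> I \<inter> ball c \<delta>" for x y
      using le[OF that] le[OF that(2,1)] mdist_commute[of \<rho>] by (metis abs_minus_commute linear)
    moreover have "\<delta> > 0" "C > 0" using e e' by (auto simp: \<delta>_def C_def)
    ultimately show ?thesis using 3 by blast
  qed
qed

text \<open>Radii are divided by \<open>\<bar>m\<bar>\<close> and Lipschitz constants are multiplied
  by it.\<close>

lemma lipschitz_curve_affine:
  assumes \<rho>: "mspace \<rho> = UNIV" and m: "m \<noteq> 0" and \<gamma>: "lipschitz_curve \<rho> I \<gamma>"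
  shows "lipschitz_curve \<rho> ((\<lambda>t. m * t + c) -` I) (\<lambda>t. \<gamma> (m * t + c))"
  unfolding lipschitz_curve_iff[OF \<rho>]
proof (intro conjI ballI)
  show "continuous_curve ((\<lambda>t. m * t + c) -` I) (\<lambda>t. \<gamma> (m * t + c))"
    using continuous_curve_affine m \<gamma> unfolding lipschitz_curve_def by blast
  fix t assume t: "t \<in> (\<lambda>t. m * t + c) -` I"
  then obtain \<epsilon> B where e: "\<epsilon> > 0" "B > 0" "\<And>x y. x \<in> I \<inter> ball (m * t + c) \<epsilon> \<Longrightarrow>
        y \<in> I \<inter> ball (m * t + c) \<epsilon> \<Longrightarrow> mdist \<rho> (\<gamma> x) (\<gamma> y) \<le> B * \<bar>x - y\<bar>"
    using \<gamma> unfolding lipschitz_curve_iff[OF \<rho>] by (metis vimage_eq)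
  have d: "\<bar>m * x - m * y\<bar> = \<bar>m\<bar> * \<bar>x - y\<bar>" for x y
    by (simp flip: abs_mult add: right_diff_distrib)
  have "mdist \<rho> (\<gamma> (m * x + c)) (\<gamma> (m * y + c)) \<le> (B * \<bar>m\<bar>) * \<bar>x - y\<bar>"
    if "x \<in> (\<lambda>t. m * t + c) -` I \<inter> ball t (\<epsilon> / \<bar>m\<bar>)" "y \<in> (\<lambda>t. m * t + c) -` I \<inter> ball t (\<epsilon> / \<bar>m\<bar>)" for x y
  proof -
    have b: "m * z + c \<in> ball (m * t + c) \<epsilon>" if "z \<in> ball t (\<epsilon> / \<bar>m\<bar>)" for z
      using that m d[of t z] by (simp add: dist_real_def pos_less_divide_eq mult.commute)
    have "mdist \<rho> (\<gamma> (m * x + c)) (\<gamma> (m * y + c)) \<le> B * \<bar>(m * x + c) - (m * y + c)\<bar>"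
      using that by (intro e(3) IntI b) auto
    then show ?thesis using d[of x y] by (simp add: mult.assoc)
  qed
  moreover have "\<epsilon> / \<bar>m\<bar> > 0" "B * \<bar>m\<bar> > 0" using e m by auto
  ultimately show "\<exists>\<epsilon>>0. \<exists>B>0. \<forall>x\<in>(\<lambda>t. m * t + c) -` I \<inter> ball t \<epsilon>. \<forall>y\<in>(\<lambda>t. m * t + c) -` I \<inter> ball t \<epsilon>.
      mdist \<rho> (\<gamma> (m * x + c)) (\<gamma> (m * y + c)) \<le> B * \<bar>x - y\<bar>"
    by blast
qed

lemma lipschitz_curve_sing:
  assumes \<rho>: "mspace \<rho> = UNIV"
  shows "lipschitz_curve \<rho> {a} \<gamma>"
proof -
  have "mdist \<rho> (\<gamma> a) (\<gamma> a) = 0" using \<rho> by (metis UNIV_I mdist_zero)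
  then show ?thesis
    unfolding lipschitz_curve_iff[OF \<rho>] using continuous_curve_sing[of a \<gamma>] by (auto intro!: exI[of _ "1::real"])
qed

lemma lipschitz_curve_cong:
  assumes \<rho>: "mspace \<rho> = UNIV" and "lipschitz_curve \<rho> I \<gamma>" "\<And>t. t \<in> I \<Longrightarrow> \<gamma> t = \<gamma>' t"
  shows "lipschitz_curve \<rho> I \<gamma>'"
  using assms(2,3) continuous_curve_cong[of I \<gamma> \<gamma>'] unfolding lipschitz_curve_iff[OF \<rho>] by simp

lemma lipschitz_curve_ray:
  assumes \<rho>: "mspace \<rho> = UNIV" and \<gamma>: "\<And>n. lipschitz_curve \<rho> {0..real n} \<gamma>"
  shows "lipschitz_curve \<rho> {0..} \<gamma>"
  unfolding lipschitz_curve_iff[OF \<rho>]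
proof (intro conjI ballI)
  show "continuous_curve {0..} \<gamma>" using \<gamma> continuous_curve_ray unfolding lipschitz_curve_def by blast
  fix t :: real assume t: "t \<in> {0..}"
  obtain n where n: "t < real n" using reals_Archimedean2 by blast
  obtain \<epsilon> B where e: "\<epsilon> > 0" "B > 0" "\<And>x y. x \<in> {0..real n} \<inter> ball t \<epsilon> \<Longrightarrow>
        y \<in> {0..real n} \<inter> ball t \<epsilon> \<Longrightarrow> mdist \<rho> (\<gamma> x) (\<gamma> y) \<le> B * \<bar>x - y\<bar>"
    using \<gamma>[of n] t n unfolding lipschitz_curve_iff[OF \<rho>] by (metis atLeastAtMost_iff atLeast_iff less_imp_le)
  \<comment> \<open>The ball has to stay below \<open>real n\<close>, where the bound on
    \<open>{0..real n}\<close> applies.\<close>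
  show "\<exists>\<epsilon>>0. \<exists>B>0. \<forall>x\<in>{0..} \<inter> ball t \<epsilon>. \<forall>y\<in>{0..} \<inter> ball t \<epsilon>. mdist \<rho> (\<gamma> x) (\<gamma> y) \<le> B * \<bar>x - y\<bar>"
    by (intro exI[of _ "min \<epsilon> (real n - t)"] exI[of _ B] conjI ballI e(3))
      (use e n in \<open>auto simp: dist_real_def\<close>)
qed

lemma admissible_curves_lipschitz:
  assumes "mspace \<rho> = UNIV"
  shows "admissible_curves (lipschitz_curve \<rho>)"
  by (rule admissible_curves.intro)
    (simp add: lipschitz_curve_def; fail | rule lipschitz_curve_subset lipschitz_curve_glue[OF assms]
        lipschitz_curve_affine[OF assms] lipschitz_curve_sing[OF assms] lipschitz_curve_cong[OF assms]
        lipschitz_curve_ray[OF assms]; assumption)+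

section \<open>Timelike curves in a space with finite Lorentzian distance\<close>

lemma homeomorphism_reflect:
  fixes I :: "real set" and J :: "real set"
  assumes "homeomorphism I J \<phi> \<psi>"
  shows "homeomorphism (uminus ` I) (uminus ` J) (\<lambda>t. - \<phi> (- t)) (\<lambda>t. - \<psi> (- t))"
proof -
  have u: "homeomorphism (uminus ` K) K uminus uminus" for K :: "real set"
    by (auto simp: homeomorphism_def image_image intro!: continuous_intros)
  show ?thesis
    using homeomorphism_compose[OF homeomorphism_compose[OF u[of I] assms] homeomorphism_symD[OF u[of J]]]
    by (simp add: o_def)
qed

text \<open>The left side is written with slope and offset exactly as in \<open>crv_affine\<close>,
  of which reflection is the case \<open>m = - 1\<close>, \<open>c = 0\<close>.\<close>

lemma reflect_vimage: "(\<lambda>t. - 1 * t + 0) -` I = uminus ` (I :: real set)"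
  by (rule set_eqI) (metis add_0_right image_iff minus_minus mult_minus1 vimage_eq)

lemma is_interval_reflect: "is_interval I \<Longrightarrow> is_interval (uminus ` (I :: real set))"
  using is_interval_affine_vimage[of "-1" I 0] unfolding reflect_vimage by simp

lemma strict_mono_on_reflect:
  fixes I :: "real set" and \<phi> :: "real \<Rightarrow> real"
  shows "strict_mono_on I \<phi> \<Longrightarrow> strict_mono_on (uminus ` I) (\<lambda>t. - \<phi> (- t))"
  by (auto simp: strict_mono_on_def)

lemma (in admissible_curves) crv_reflect:
  assumes "crv I \<gamma>"
  shows "crv (uminus ` I) (\<lambda>t. \<gamma> (- t))"
  using crv_affine[of "-1" I \<gamma> 0] assms unfolding reflect_vimage by simp

text \<open>Having a greatest element is easier to transport along shifts, reflections and tails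
  than a condition on \<open>Sup\<close>.\<close>

lemma Sup_mem_iff:
  assumes "I \<noteq> {}"
  shows "bdd_above I \<and> Sup I \<in> I \<longleftrightarrow> (\<exists>m\<in>I. \<forall>t\<in>I. t \<le> (m::real))"
proof
  assume "bdd_above I \<and> Sup I \<in> I"
  then show "\<exists>m\<in>I. \<forall>t\<in>I. t \<le> m" by (intro bexI[of _ "Sup I"]) (auto intro: cSup_upper)
next
  assume "\<exists>m\<in>I. \<forall>t\<in>I. t \<le> m"
  then obtain m where m: "m \<in> I" "\<And>t. t \<in> I \<Longrightarrow> t \<le> m" by blast
  then have "Sup I = m" by (intro cSup_eq_maximum) auto
  then show "bdd_above I \<and> Sup I \<in> I" using m by (auto simp: bdd_above_def)
qed

lemma reflect_reflect [simp]: "uminus ` uminus ` I = (I :: real set)"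
  by (simp add: image_image)

locale finite_time_separation = admissible_curves crv
  for crv :: "'a::topological_space curve_class" +
  fixes l :: "'a \<Rightarrow> 'a \<Rightarrow> ereal"
  assumes time_separation: "time_separation l" and finite_ldist: "finite_ldist l"
begin

text \<open>Exchanging the arguments of \<open>l\<close> reverses time. The main statements about
  the past, such as \<open>past_cauchy_complete_tail\<close> and
  \<open>exists_past_inextendible\<close>, are derived from their future versions through this
  interpretation and a reflection of the parameter.\<close>

lemma dual: "finite_time_separation crv (\<lambda>x y. l y x)"
proof unfold_locales
  show "time_separation (\<lambda>x y. l y x)"
  proof -
    have "plus_lower a b = plus_lower b a" for a b
      by (simp add: plus_lower_def add.commute)
    then show ?thesis using time_separation unfolding time_separation_def by metis
  qed
  show "finite_ldist (\<lambda>x y. l y x)"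
    using finite_ldist unfolding finite_ldist_def ldist_def by blast
qed

section \<open>Causal and chronological relations\<close>

lemma ldist_nonneg [simp]: "0 \<le> ldist l x y"
  by (simp add: ldist_def)

lemma ldist_finite [simp]: "ldist l x y \<noteq> \<infinity>" "ldist l x y < \<infinity>"
  using finite_ldist by (auto simp: finite_ldist_def less_top)

lemma causal_refl [simp]: "causal_le l x x"
  using time_separation by (auto simp: time_separation_def causal_le_def)

lemma chron_iff: "chron_less l x y \<longleftrightarrow> 0 < l x y"
  by (auto simp: chron_less_def ldist_def less_max_iff_disj)

lemma chron_imp_causal: "chron_less l x y \<Longrightarrow> causal_le l x y"
  by (auto simp: chron_iff causal_le_def)

text \<open>Along causally related points no value of \<open>l\<close> is
  \<open>- \<infinity>\<close>, so \<open>plus_lower\<close> is ordinary addition; all three values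
  are nonnegative, so \<open>ldist\<close> equals \<open>l\<close> on them.\<close>

lemma reverse_triangle:
  assumes "causal_le l x y" "causal_le l y z"
  shows "ldist l x y + ldist l y z \<le> ldist l x z" "causal_le l x z"
proof -
  have "plus_lower (l x y) (l y z) \<le> l x z" using time_separation by (auto simp: time_separation_def)
  moreover have "l x y \<noteq> -\<infinity>" "l y z \<noteq> -\<infinity>" using assms by (auto simp: causal_le_def)
  ultimately have le: "l x y + l y z \<le> l x z" by (simp add: plus_lower_def)
  moreover have "0 \<le> l x y + l y z" using assms unfolding causal_le_def by (rule add_nonneg_nonneg)
  ultimately have "0 \<le> l x z" by order
  with assms le show "ldist l x y + ldist l y z \<le> ldist l x z" "causal_le l x z"
    by (auto simp: causal_le_def ldist_def max_def)
qed

lemma ldist_mono: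
  assumes "causal_le l x y" "causal_le l y z"
  shows "ldist l x y \<le> ldist l x z" "ldist l y z \<le> ldist l x z"
proof -
  have "ldist l x y + 0 \<le> ldist l x y + ldist l y z" "0 + ldist l y z \<le> ldist l x y + ldist l y z"
    by (intro add_mono; simp)+
  with reverse_triangle(1)[OF assms] show "ldist l x y \<le> ldist l x z" "ldist l y z \<le> ldist l x z"
    by (auto intro: order_trans)
qed

lemma chron_causal_trans: "chron_less l x y \<Longrightarrow> causal_le l y z \<Longrightarrow> chron_less l x z"
  using ldist_mono(1)[of x y z] chron_imp_causal[of x y] unfolding chron_less_def by (meson less_le_trans)

lemma causal_chron_trans: "causal_le l x y \<Longrightarrow> chron_less l y z \<Longrightarrow> chron_less l x z"
  using ldist_mono(2)[of x y z] chron_imp_causal[of y z] unfolding chron_less_def by (meson less_le_trans)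

lemma chron_trans: "chron_less l x y \<Longrightarrow> chron_less l y z \<Longrightarrow> chron_less l x z"
  using chron_causal_trans chron_imp_causal by blast

text \<open>Here finiteness enters: the reverse triangle inequality at a single point bounds twice
  the distance of \<open>x\<close> to itself by that distance, which forces a finite nonnegative
  value to vanish.\<close>

lemma chron_irrefl [simp]: "\<not> chron_less l x x"
proof
  assume x: "chron_less l x x"
  obtain r where r: "ldist l x x = ereal r"
    using ldist_finite(1)[of x x] ldist_nonneg[of x x] by (cases "ldist l x x") auto
  have "ldist l x x + ldist l x x \<le> ldist l x x" by (rule reverse_triangle(1)) auto
  with x r show False by (simp add: chron_less_def)
qed

lemma chron_asym: "chron_less l x y \<Longrightarrow> \<not> chron_less l y x"
  using chron_trans chron_irrefl by blast

lemma ldist_eq_0_iff: "ldist l x y = 0 \<longleftrightarrow> \<not> chron_less l x y"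
  using ldist_nonneg[of x y] by (auto simp: chron_less_def order_less_le)

section \<open>Timelike curves and their concatenation\<close>

lemma timelike_less: "timelike_curve l crv I \<gamma> \<Longrightarrow> s \<in> I \<Longrightarrow> t \<in> I \<Longrightarrow> s < t \<Longrightarrow> chron_less l (\<gamma> s) (\<gamma> t)"
  by (simp add: timelike_curve_def)

lemma timelike_le: "timelike_curve l crv I \<gamma> \<Longrightarrow> s \<in> I \<Longrightarrow> t \<in> I \<Longrightarrow> s \<le> t \<Longrightarrow> causal_le l (\<gamma> s) (\<gamma> t)"
  using timelike_less[of I \<gamma> s t] chron_imp_causal by (cases "s = t") auto

lemma timelike_interval:
  assumes "timelike_curve l crv I \<gamma>"
  shows "is_interval I" "I \<noteq> {}" "continuous_on I \<gamma>"
  using assms crv_continuous_curve unfolding timelike_curve_def continuous_curve_def by blast+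

lemma crv_interval:
  assumes "crv I \<gamma>"
  shows "is_interval I" "I \<noteq> {}" "continuous_on I \<gamma>"
  using assms crv_continuous_curve unfolding continuous_curve_def by blast+

lemma timelike_affine:
  "m > 0 \<Longrightarrow> timelike_curve l crv I \<gamma> \<Longrightarrow>
    timelike_curve l crv ((\<lambda>t. m * t + c) -` I) (\<lambda>t. \<gamma> (m * t + c))"
  using crv_affine[of m I \<gamma> c] unfolding timelike_curve_def by simp

text \<open>Neither curve has to start or end at \<open>c\<close>: everything of the first beyond
  \<open>c\<close> and of the second before \<open>c\<close> is cut off.\<close>

abbreviation join_dom :: "real set \<Rightarrow> real \<Rightarrow> real set \<Rightarrow> real set" where
  "join_dom I c J \<equiv> (I \<inter> {..c}) \<union> (J \<inter> {c..})"

abbreviation join :: "(real \<Rightarrow> 'a) \<Rightarrow> real \<Rightarrow> (real \<Rightarrow> 'a) \<Rightarrow> real \<Rightarrow> 'a" where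
  "join \<gamma> c \<sigma> \<equiv> (\<lambda>t. if t \<le> c then \<gamma> t else \<sigma> t)"

lemma crv_join:
  assumes "crv I \<gamma>" "crv J \<sigma>" "c \<in> I" "c \<in> J" "\<gamma> c = \<sigma> c"
  shows "crv (join_dom I c J) (join \<gamma> c \<sigma>)"
proof (rule crv_glue)
  have I: "is_interval I" "is_interval J" using assms crv_interval by blast+
  show "is_interval (join_dom I c J)"
    unfolding is_interval_1
  proof (intro ballI allI impI)
    fix a b x assume ab: "a \<in> join_dom I c J" "b \<in> join_dom I c J" "a \<le> x \<and> x \<le> b"
    have "x \<in> I" if "x \<le> c"
    proof -
      have "a \<in> I" using ab that assms(3) by (cases "a = c") auto
      then show ?thesis using I(1) assms(3) ab that unfolding is_interval_1 by blast
    qed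
    moreover have "x \<in> J" if "c \<le> x"
    proof -
      have "b \<in> J" using ab that assms(4) by (cases "b = c") auto
      then show ?thesis using I(2) assms(4) ab that unfolding is_interval_1 by blast
    qed
    ultimately show "x \<in> join_dom I c J" using linear[of x c] by auto
  qed
  show "c \<in> join_dom I c J" using assms by auto
  have eq: "join_dom I c J \<inter> {..c} = I \<inter> {..c}" "join_dom I c J \<inter> {c..} = J \<inter> {c..}"
    using assms by auto
  have "is_interval (I \<inter> {..c})" "is_interval (J \<inter> {c..})"
    using I by (simp_all add: is_interval_Int is_interval_ic is_interval_ci)
  moreover have "I \<inter> {..c} \<noteq> {}" "J \<inter> {c..} \<noteq> {}" using assms by auto
  ultimately have sub: "crv (I \<inter> {..c}) \<gamma>" "crv (J \<inter> {c..}) \<sigma>"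
    using crv_subset[OF assms(1)] crv_subset[OF assms(2)] by simp_all
  show "crv (join_dom I c J \<inter> {..c}) (join \<gamma> c \<sigma>)"
    unfolding eq by (rule crv_cong[OF sub(1)]) auto
  show "crv (join_dom I c J \<inter> {c..}) (join \<gamma> c \<sigma>)"
    unfolding eq by (rule crv_cong[OF sub(2)]) (use assms(5) in auto)
qed

lemma timelike_join:
  assumes \<gamma>: "timelike_curve l crv I \<gamma>" and \<sigma>: "timelike_curve l crv J \<sigma>"
    and c: "c \<in> I" "c \<in> J" "\<gamma> c = \<sigma> c"
  shows "timelike_curve l crv (join_dom I c J) (join \<gamma> c \<sigma>)"
  unfolding timelike_curve_def
proof (intro conjI ballI impI)
  show "crv (join_dom I c J) (join \<gamma> c \<sigma>)"
    using assms crv_join unfolding timelike_curve_def by blast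
  fix t s assume ts: "t \<in> join_dom I c J" "s \<in> join_dom I c J" "t < s"
  consider "s \<le> c" | "c < t" | "t \<le> c" "c < s" using ts by linarith
  then show "chron_less l (join \<gamma> c \<sigma> t) (join \<gamma> c \<sigma> s)"
  proof cases
    case 1
    then have "s \<in> I" using ts c by (cases "s = c") auto
    then show ?thesis using 1 ts timelike_less[OF \<gamma>, of t s] by auto
  next
    case 2
    then show ?thesis using ts timelike_less[OF \<sigma>, of t s] by auto
  next
    case 3
    then have "causal_le l (\<gamma> t) (\<gamma> c)" "chron_less l (\<sigma> c) (\<sigma> s)"
      using ts timelike_le[OF \<gamma>, of t c] timelike_less[OF \<sigma>, of c s] c by auto
    then show ?thesis using 3 c causal_chron_trans by simp
  qed
qed

section \<open>Extendibility and time reversal\<close>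

text \<open>The homeomorphism and the intermediate interval of the definition are recovered from
  \<open>\<phi>\<close> alone: a continuous strictly monotone map on an interval is a homeomorphism
  onto its image, and the image is connected, hence an interval.\<close>

lemma future_extendible_iff:
  assumes I: "is_interval I"
  shows "future_extendible l crv I \<gamma> \<longleftrightarrow>
    (\<exists>\<phi> J \<gamma>' t. continuous_on I \<phi> \<and> strict_mono_on I \<phi> \<and> \<phi> ` I \<subseteq> J \<and> t \<in> J \<and> (\<forall>s\<in>I. \<phi> s < t) \<and>
       causal_curve l crv J \<gamma>' \<and> (\<forall>s\<in>I. \<gamma>' (\<phi> s) = \<gamma> s))" (is "_ \<longleftrightarrow> ?R")
proof
  assume "future_extendible l crv I \<gamma>"
  then obtain \<phi> \<psi> I' I'' \<gamma>' t where *: "homeomorphism I I' \<phi> \<psi>" "strict_mono_on I \<phi>" "I' \<subseteq> I''"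
    "t \<in> I''" "\<forall>s\<in>I'. s < t" "causal_curve l crv I'' \<gamma>'" "\<forall>s\<in>I'. \<gamma>' s = \<gamma> (\<psi> s)"
    unfolding future_extendible_def by blast
  show ?R
    by (rule exI[of _ \<phi>], rule exI[of _ I''], rule exI[of _ \<gamma>'], rule exI[of _ t])
      (use * in \<open>auto simp: homeomorphism_def\<close>)
next
  assume ?R
  then obtain \<phi> J \<gamma>' t where *: "continuous_on I \<phi>" "strict_mono_on I \<phi>" "\<phi> ` I \<subseteq> J" "t \<in> J" "\<forall>s\<in>I. \<phi> s < t"
       "causal_curve l crv J \<gamma>'" "\<forall>s\<in>I. \<gamma>' (\<phi> s) = \<gamma> s" by blast
  obtain \<psi> where \<psi>: "homeomorphism I (\<phi> ` I) \<phi> \<psi>"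
    using homeomorphism_into_1d[of I \<phi> "\<phi> ` I"] * I strict_mono_on_imp_inj_on is_interval_path_connected by blast
  moreover have "is_interval (\<phi> ` I)"
    using *(1) I connected_continuous_image is_interval_connected_1 by blast
  moreover have "is_interval J" using *(6) crv_interval unfolding causal_curve_def by blast
  moreover have "\<forall>s\<in>\<phi> ` I. s < t" "\<forall>s\<in>\<phi> ` I. \<gamma>' s = \<gamma> (\<psi> s)"
    using * \<psi> by (auto simp: homeomorphism_def)
  ultimately show "future_extendible l crv I \<gamma>"
    unfolding future_extendible_def using * by blast
qed

lemma causal_dual:
  assumes "causal_curve l crv I \<gamma>"
  shows "causal_curve (\<lambda>x y. l y x) crv (uminus ` I) (\<lambda>t. \<gamma> (- t))"
  unfolding causal_curve_def
proof (intro conjI ballI impI)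
  show "crv (uminus ` I) (\<lambda>t. \<gamma> (- t))"
    using crv_reflect assms unfolding causal_curve_def by blast
  fix a b assume ab: "a \<in> uminus ` I" "b \<in> uminus ` I" "a < b"
  then show "causal_le (\<lambda>x y. l y x) (\<gamma> (- a)) (\<gamma> (- b))"
    using assms by (auto simp: causal_curve_def causal_le_def)
  show "\<not> (\<lambda>t. \<gamma> (- t)) constant_on {a..b}"
  proof
    assume "(\<lambda>t. \<gamma> (- t)) constant_on {a..b}"
    then obtain y where y: "\<And>t. t \<in> {a..b} \<Longrightarrow> \<gamma> (- t) = y" unfolding constant_on_def by blast
    have "\<gamma> t = y" if "t \<in> {- b..- a}" for t using y[of "- t"] that by auto
    then have "\<gamma> constant_on {- b..- a}" unfolding constant_on_def by blast
    then show False using assms ab unfolding causal_curve_def by auto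
  qed
qed

lemma timelike_dual:
  "timelike_curve l crv I \<gamma> \<Longrightarrow> timelike_curve (\<lambda>x y. l y x) crv (uminus ` I) (\<lambda>t. \<gamma> (- t))"
  using crv_reflect[of I \<gamma>] by (auto simp: timelike_curve_def chron_less_def ldist_def)

text \<open>The reparametrisation and its inverse are conjugated by reflection, which moves the
  parameter beyond the image to the other side.\<close>

lemma future_extendible_dual:
  assumes "future_extendible l crv I \<gamma>"
  shows "past_extendible (\<lambda>x y. l y x) crv (uminus ` I) (\<lambda>t. \<gamma> (- t))"
proof -
  obtain \<phi> \<psi> I' I'' \<gamma>' t where *: "is_interval I'" "homeomorphism I I' \<phi> \<psi>" "strict_mono_on I \<phi>"
    "is_interval I''" "I' \<subseteq> I''" "t \<in> I''" "\<forall>s\<in>I'. s < t" "causal_curve l crv I'' \<gamma>'" "\<forall>s\<in>I'. \<gamma>' s = \<gamma> (\<psi> s)"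
    using assms unfolding future_extendible_def by blast
  have "uminus ` I' \<subseteq> uminus ` I''" using *(5) by blast
  moreover have "\<exists>t\<in>uminus ` I''. \<forall>s\<in>uminus ` I'. t < s" using *(6,7) by fastforce
  moreover have "\<forall>s\<in>uminus ` I'. \<gamma>' (- s) = \<gamma> (- (- \<psi> (- s)))" using *(9) by simp
  ultimately show ?thesis
    unfolding past_extendible_def
    using is_interval_reflect[OF *(1)] is_interval_reflect[OF *(4)] homeomorphism_reflect[OF *(2)]
      strict_mono_on_reflect[OF *(3)] causal_dual[OF *(8)]
    by (intro exI[of _ "\<lambda>t. - \<phi> (- t)"] exI[of _ "\<lambda>t. - \<psi> (- t)"]
        exI[of _ "uminus ` I'"] exI[of _ "uminus ` I''"] exI[of _ "\<lambda>t. \<gamma>' (- t)"] conjI)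
qed

lemma past_extendible_dual:
  assumes "past_extendible l crv I \<gamma>"
  shows "future_extendible (\<lambda>x y. l y x) crv (uminus ` I) (\<lambda>t. \<gamma> (- t))"
proof -
  obtain \<phi> \<psi> I' I'' \<gamma>' t where *: "is_interval I'" "homeomorphism I I' \<phi> \<psi>" "strict_mono_on I \<phi>"
    "is_interval I''" "I' \<subseteq> I''" "t \<in> I''" "\<forall>s\<in>I'. t < s" "causal_curve l crv I'' \<gamma>'" "\<forall>s\<in>I'. \<gamma>' s = \<gamma> (\<psi> s)"
    using assms unfolding past_extendible_def by blast
  have "uminus ` I' \<subseteq> uminus ` I''" using *(5) by blast
  moreover have "\<exists>t\<in>uminus ` I''. \<forall>s\<in>uminus ` I'. s < t" using *(6,7) by fastforce
  moreover have "\<forall>s\<in>uminus ` I'. \<gamma>' (- s) = \<gamma> (- (- \<psi> (- s)))" using *(9) by simp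
  ultimately show ?thesis
    unfolding future_extendible_def
    using is_interval_reflect[OF *(1)] is_interval_reflect[OF *(4)] homeomorphism_reflect[OF *(2)]
      strict_mono_on_reflect[OF *(3)] causal_dual[OF *(8)]
    by (intro exI[of _ "\<lambda>t. - \<phi> (- t)"] exI[of _ "\<lambda>t. - \<psi> (- t)"]
        exI[of _ "uminus ` I'"] exI[of _ "uminus ` I''"] exI[of _ "\<lambda>t. \<gamma>' (- t)"] conjI)
qed

section \<open>Concatenation of causal curves and extendibility of tails\<close>

lemma timelike_imp_causal:
  assumes "timelike_curve l crv I \<gamma>"
  shows "causal_curve l crv I \<gamma>"
  unfolding causal_curve_def
proof (intro conjI ballI impI)
  show "crv I \<gamma>" using assms by (simp add: timelike_curve_def)
  fix a b assume ab: "a \<in> I" "b \<in> I" "a < b"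
  then have *: "chron_less l (\<gamma> a) (\<gamma> b)" using assms timelike_less by blast
  then show "causal_le l (\<gamma> a) (\<gamma> b)" by (rule chron_imp_causal)
  show "\<not> \<gamma> constant_on {a..b}"
  proof
    assume "\<gamma> constant_on {a..b}"
    then have "\<gamma> a = \<gamma> b" using ab unfolding constant_on_def by fastforce
    then show False using * by simp
  qed
qed

lemma causal_join:
  assumes \<gamma>: "causal_curve l crv I \<gamma>" and \<sigma>: "causal_curve l crv J \<sigma>"
    and c: "c \<in> I" "c \<in> J" "\<gamma> c = \<sigma> c"
  shows "causal_curve l crv (join_dom I c J) (join \<gamma> c \<sigma>)"
  unfolding causal_curve_def
proof (intro conjI ballI impI)
  show "crv (join_dom I c J) (join \<gamma> c \<sigma>)"
    using assms crv_join unfolding causal_curve_def by blast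
  fix t s assume ts: "t \<in> join_dom I c J" "s \<in> join_dom I c J" "t < s"
  have tI: "t \<in> I" if "t \<le> c" using that ts c by (cases "t = c") auto
  have sI: "s \<in> I" if "s \<le> c" using that ts c by (cases "s = c") auto
  have tJ: "t \<in> J" if "c \<le> t" using that ts c by (cases "t = c") auto
  have sJ: "s \<in> J" if "c \<le> s" using that ts c by (cases "s = c") auto
  have le\<gamma>: "causal_le l (\<gamma> u) (\<gamma> v)" if "u \<in> I" "v \<in> I" "u \<le> v" for u v
    using \<gamma> that unfolding causal_curve_def by (cases "u = v") auto
  have le\<sigma>: "causal_le l (\<sigma> u) (\<sigma> v)" if "u \<in> J" "v \<in> J" "u \<le> v" for u v
    using \<sigma> that unfolding causal_curve_def by (cases "u = v") auto
  consider "s \<le> c" | "c < t" | "t \<le> c" "c < s" using ts by linarith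
  then show "causal_le l (join \<gamma> c \<sigma> t) (join \<gamma> c \<sigma> s)"
  proof cases
    case 1
    then show ?thesis using le\<gamma>[of t s] tI sI ts by auto
  next
    case 2
    then show ?thesis using le\<sigma>[of t s] tJ sJ ts by auto
  next
    case 3
    then have "causal_le l (\<gamma> t) (\<gamma> c)" "causal_le l (\<sigma> c) (\<sigma> s)"
      using le\<gamma>[of t c] le\<sigma>[of c s] tI sJ c by simp_all
    then show ?thesis using 3 c reverse_triangle(2) by simp
  qed
  show "\<not> join \<gamma> c \<sigma> constant_on {t..s}"
  proof
    assume "join \<gamma> c \<sigma> constant_on {t..s}"
    then obtain y where y: "\<And>u. u \<in> {t..s} \<Longrightarrow> join \<gamma> c \<sigma> u = y" unfolding constant_on_def by blast
    \<comment> \<open>An interval on which the joined curve is constant contains a nondegenerate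
      part on one side of \<open>c\<close>, where one of the two causal curves would be
      constant.\<close>
    show False
    proof (cases "t < c")
      case True
      have "\<gamma> u = y" if "u \<in> {t..min s c}" for u using y[of u] that by simp
      then have "\<gamma> constant_on {t..min s c}" unfolding constant_on_def by blast
      moreover have "min s c \<in> I" using c sI by (auto simp: min_def)
      moreover have "t \<in> I" "t < min s c" using True tI ts by auto
      ultimately show False using \<gamma> unfolding causal_curve_def by blast
    next
      case False
      have "\<sigma> u = y" if "u \<in> {t..s}" for u using y[of u] that False c by (cases "u = c") auto
      then have "\<sigma> constant_on {t..s}" unfolding constant_on_def by blast
      moreover have "t \<in> J" "s \<in> J" using False ts tJ sJ by auto
      ultimately show False using \<sigma> ts unfolding causal_curve_def by blast
    qed
  qed
qed

lemma future_extendible_tail: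
  assumes "is_interval I" "future_extendible l crv I \<gamma>"
  shows "future_extendible l crv (I \<inter> {c..}) \<gamma>"
proof -
  have I': "is_interval (I \<inter> {c..})" using assms(1) by (simp add: is_interval_Int is_interval_ci)
  obtain \<phi> J \<gamma>' t where *: "continuous_on I \<phi>" "strict_mono_on I \<phi>" "\<phi> ` I \<subseteq> J" "t \<in> J" "\<forall>s\<in>I. \<phi> s < t"
       "causal_curve l crv J \<gamma>'" "\<forall>s\<in>I. \<gamma>' (\<phi> s) = \<gamma> s"
    using assms unfolding future_extendible_iff[OF assms(1)] by blast
  show ?thesis
    unfolding future_extendible_iff[OF I']
    by (rule exI[of _ \<phi>], rule exI[of _ J], rule exI[of _ \<gamma>'], rule exI[of _ t])
      (use * in \<open>auto intro: continuous_on_subset simp: strict_mono_on_def\<close>)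
qed

lemma future_extendible_cong:
  assumes "is_interval I" "future_extendible l crv I \<gamma>" "\<And>t. t \<in> I \<Longrightarrow> \<gamma> t = \<sigma> t"
  shows "future_extendible l crv I \<sigma>"
  using assms(2,3) unfolding future_extendible_iff[OF assms(1)] by metis

text \<open>An extension of the tail is made into one of the whole curve: the reparametrisation
  \<open>\<phi>\<close> of the tail is continued to the left of \<open>c\<close> by a translation,
  and the curve \<open>\<gamma>\<close>, translated accordingly, is joined to the extension at
  \<open>\<phi> c\<close>.\<close>

lemma future_extendible_tailD:
  assumes \<gamma>: "timelike_curve l crv I \<gamma>" and c: "c \<in> I"
    and ext: "future_extendible l crv (I \<inter> {c..}) \<gamma>"
  shows "future_extendible l crv I \<gamma>"
proof -
  have I: "is_interval I" using \<gamma> timelike_interval by blast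
  then have I': "is_interval (I \<inter> {c..})" by (simp add: is_interval_Int is_interval_ci)
  obtain \<phi> J \<gamma>' t where *: "continuous_on (I \<inter> {c..}) \<phi>" "strict_mono_on (I \<inter> {c..}) \<phi>" "\<phi> ` (I \<inter> {c..}) \<subseteq> J" "t \<in> J"
    "\<forall>s\<in>I \<inter> {c..}. \<phi> s < t" "causal_curve l crv J \<gamma>'" "\<forall>s\<in>I \<inter> {c..}. \<gamma>' (\<phi> s) = \<gamma> s"
    using ext unfolding future_extendible_iff[OF I'] by blast
  \<comment> \<open>The offset \<open>\<phi> c - c\<close> makes the two branches agree at
    \<open>c\<close>.\<close>
  define \<phi>' where "\<phi>' s = (if s \<le> c then s + (\<phi> c - c) else \<phi> s)" for s
  define K where "K = (\<lambda>t. 1 * t + (c - \<phi> c)) -` I"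
  define \<kappa> where "\<kappa> t = \<gamma> (1 * t + (c - \<phi> c))" for t
  have "timelike_curve l crv K \<kappa>"
    unfolding K_def \<kappa>_def by (rule timelike_affine[OF _ \<gamma>]) simp
  then have ext': "causal_curve l crv (join_dom K (\<phi> c) J) (join \<kappa> (\<phi> c) \<gamma>')"
    by (rule causal_join[OF timelike_imp_causal *(6)]) (use *(3,7) c in \<open>auto simp: K_def \<kappa>_def\<close>)
  have IU: "(I \<inter> {..c}) \<union> (I \<inter> {c..}) = I" by auto
  have "continuous_on ((I \<inter> {..c}) \<union> (I \<inter> {c..})) \<phi>'"
  proof (rule continuous_on_Un_local)
    show "continuous_on (I \<inter> {..c}) \<phi>'"
      by (rule continuous_on_eq[of _ "\<lambda>s. s + (\<phi> c - c)"]) (auto simp: \<phi>'_def intro!: continuous_intros)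
    show "continuous_on (I \<inter> {c..}) \<phi>'"
      by (rule continuous_on_eq[OF *(1)]) (auto simp: \<phi>'_def)
  qed (simp_all add: IU closedin_closed_Int)
  then have cont: "continuous_on I \<phi>'" by (simp add: IU)
  have mono: "\<phi> r < \<phi> s" if "r \<in> I" "s \<in> I" "c \<le> r" "r < s" for r s
    using strict_mono_onD[OF *(2), of r s] that by auto
  have sm: "strict_mono_on I \<phi>'"
  proof (rule strict_mono_onI)
    fix r s assume rs: "r \<in> I" "s \<in> I" "r < s"
    show "\<phi>' r < \<phi>' s"
      using mono[of r s] mono[of c s] rs c by (auto simp: \<phi>'_def)
  qed
  have above: "\<phi> c < \<phi> s" if "s \<in> I" "s > c" for s using mono[of c s] that c by auto
  have "\<phi>' s \<in> join_dom K (\<phi> c) J" if "s \<in> I" for s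
    using *(3) above[of s] that by (cases "s \<le> c") (auto simp: \<phi>'_def K_def image_subset_iff)
  then have "\<phi>' ` I \<subseteq> join_dom K (\<phi> c) J" by blast
  moreover have tc: "\<phi> c < t" using *(5) c by simp
  then have "t \<in> join_dom K (\<phi> c) J" using *(4) by auto
  moreover have "\<forall>s\<in>I. \<phi>' s < t" using *(5) tc by (auto simp: \<phi>'_def)
  moreover have "join \<kappa> (\<phi> c) \<gamma>' (\<phi>' s) = \<gamma> s" if "s \<in> I" for s
    using *(7) above[of s] that by (cases "s \<le> c") (auto simp: \<phi>'_def \<kappa>_def)
  ultimately show ?thesis
    unfolding future_extendible_iff[OF I] using cont sm ext'
    by (intro exI[of _ \<phi>'] exI[of _ "join_dom K (\<phi> c) J"] exI[of _ "join \<kappa> (\<phi> c) \<gamma>'"] exI[of _ t]) simp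
qed

text \<open>Extendibility passes from \<open>\<sigma>\<close> to the common tail by restriction, and
  from there to \<open>\<gamma>\<close> by \<open>future_extendible_tailD\<close>.\<close>

lemma future_extendible_same_tail:
  assumes \<gamma>: "timelike_curve l crv I \<gamma>" and \<sigma>: "timelike_curve l crv J \<sigma>"
    and c: "c \<in> I" and tail: "I \<inter> {c..} = J \<inter> {c..}" "\<And>t. t \<in> I \<Longrightarrow> c \<le> t \<Longrightarrow> \<gamma> t = \<sigma> t"
    and ext: "future_extendible l crv J \<sigma>"
  shows "future_extendible l crv I \<gamma>"
proof (rule future_extendible_tailD[OF \<gamma> c])
  have I: "is_interval I" "is_interval J" using \<gamma> \<sigma> timelike_interval by blast+
  then have I': "is_interval (I \<inter> {c..})" by (simp add: is_interval_Int is_interval_ci)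
  have "future_extendible l crv (I \<inter> {c..}) \<sigma>"
    unfolding tail(1) by (rule future_extendible_tail[OF I(2) ext])
  then show "future_extendible l crv (I \<inter> {c..}) \<gamma>"
    by (rule future_extendible_cong[OF I']) (use tail(2) in auto)
qed

section \<open>Cauchy completeness\<close>

lemma future_cauchy_complete_iff:
  "future_cauchy_complete l crv I \<gamma> \<longleftrightarrow> timelike_curve l crv I \<gamma> \<and> \<not> future_extendible l crv I \<gamma> \<and>
     ((\<exists>t0\<in>I. \<exists>C::real. \<forall>t \<in> I. t0 \<le> t \<longrightarrow> ldist l (\<gamma> t0) (\<gamma> t) \<le> ereal C) \<longrightarrow> (\<exists>m\<in>I. \<forall>t\<in>I. t \<le> m))"
proof -
  have "bdd_above I \<and> Sup I \<in> I \<longleftrightarrow> (\<exists>m\<in>I. \<forall>t\<in>I. t \<le> m)" if "timelike_curve l crv I \<gamma>"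
    by (rule Sup_mem_iff[OF timelike_interval(2)[OF that]])
  moreover have "(\<forall>t \<in> {t0..} \<inter> I. ldist l (\<gamma> t0) (\<gamma> t) \<le> ereal C) \<longleftrightarrow>
      (\<forall>t \<in> I. t0 \<le> t \<longrightarrow> ldist l (\<gamma> t0) (\<gamma> t) \<le> ereal C)" for t0 C by auto
  ultimately show ?thesis
    unfolding future_cauchy_complete_def future_inextendible_timelike_def
    by (cases "timelike_curve l crv I \<gamma>") simp_all
qed

text \<open>Only the curve from \<open>c\<close> on matters. A bound based at \<open>t0\<close>
  gives, by monotonicity of the distance, the same bound based at \<open>max t0 c\<close>, which
  lies in the common tail. A greatest parameter of \<open>I\<close> is at least \<open>c\<close> and
  hence is also one of \<open>J\<close>.\<close>

lemma future_cauchy_complete_tail: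
  assumes \<gamma>: "future_cauchy_complete l crv I \<gamma>" and \<sigma>: "timelike_curve l crv J \<sigma>"
    and c: "c \<in> I" and tail: "I \<inter> {c..} = J \<inter> {c..}" "\<And>t. t \<in> I \<Longrightarrow> c \<le> t \<Longrightarrow> \<gamma> t = \<sigma> t"
  shows "future_cauchy_complete l crv J \<sigma>"
  unfolding future_cauchy_complete_iff
proof (intro conjI impI)
  show "timelike_curve l crv J \<sigma>" by fact
  have \<gamma>': "timelike_curve l crv I \<gamma>" "\<not> future_extendible l crv I \<gamma>"
    using \<gamma> unfolding future_cauchy_complete_iff by auto
  then show "\<not> future_extendible l crv J \<sigma>"
    using future_extendible_same_tail[OF \<gamma>'(1) \<sigma> c tail] by blast
  have iff: "t \<in> I \<longleftrightarrow> t \<in> J" if "c \<le> t" for t using tail(1) that by auto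
  have cJ: "c \<in> J" using iff c by simp
  assume "\<exists>t0\<in>J. \<exists>C::real. \<forall>t\<in>J. t0 \<le> t \<longrightarrow> ldist l (\<sigma> t0) (\<sigma> t) \<le> ereal C"
  then obtain t0 C where t0: "t0 \<in> J" "\<And>t. t \<in> J \<Longrightarrow> t0 \<le> t \<Longrightarrow> ldist l (\<sigma> t0) (\<sigma> t) \<le> ereal C" by blast
  define t1 where "t1 = max t0 c"
  have t1: "t1 \<in> I" "t1 \<in> J" "t0 \<le> t1" "c \<le> t1" using t0 c cJ iff by (auto simp: t1_def max_def)
  have "ldist l (\<gamma> t1) (\<gamma> t) \<le> ereal C" if t: "t \<in> I" "t1 \<le> t" for t
  proof -
    have tJ: "t \<in> J" using iff t t1 by auto
    have "causal_le l (\<sigma> t0) (\<sigma> t1)" "causal_le l (\<sigma> t1) (\<sigma> t)"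
      using timelike_le[OF \<sigma>] t0 t1 t tJ by auto
    then have "ldist l (\<sigma> t1) (\<sigma> t) \<le> ldist l (\<sigma> t0) (\<sigma> t)" by (rule ldist_mono)
    also have "\<dots> \<le> ereal C" using t0(2) tJ t t1 by auto
    finally show ?thesis using tail(2) t t1 by auto
  qed
  then have "\<exists>m\<in>I. \<forall>t\<in>I. t \<le> m"
    using \<gamma> t1(1) unfolding future_cauchy_complete_iff by blast
  then obtain m where m: "m \<in> I" "\<And>t. t \<in> I \<Longrightarrow> t \<le> m" by blast
  have "c \<le> m" using m c by auto
  moreover have "t \<le> m" if "t \<in> J" for t using m(2)[of t] iff[of t] that \<open>c \<le> m\<close> by linarith
  ultimately show "\<exists>m\<in>J. \<forall>t\<in>J. t \<le> m" using m(1) iff by blast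
qed

lemma future_extendible_shift:
  assumes I: "is_interval I" and J: "is_interval J" and JI: "\<And>s. s \<in> J \<longleftrightarrow> s + c \<in> I"
    and \<sigma>: "\<And>s. \<sigma> s = \<gamma> (s + c)"
    and ext: "future_extendible l crv J \<sigma>"
  shows "future_extendible l crv I \<gamma>"
proof -
  obtain \<phi> K \<gamma>' t where *: "continuous_on J \<phi>" "strict_mono_on J \<phi>" "\<phi> ` J \<subseteq> K" "t \<in> K" "\<forall>s\<in>J. \<phi> s < t"
     "causal_curve l crv K \<gamma>'" "\<forall>s\<in>J. \<gamma>' (\<phi> s) = \<sigma> s"
    using ext unfolding future_extendible_iff[OF J] by blast
  have J': "s - c \<in> J" if "s \<in> I" for s using JI[of "s - c"] that by simp
  have "continuous_on I (\<lambda>s. \<phi> (s - c))"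
    by (rule continuous_on_compose2[OF *(1)]) (use J' in \<open>auto intro!: continuous_intros\<close>)
  moreover have "strict_mono_on I (\<lambda>s. \<phi> (s - c))"
  proof (rule strict_mono_onI)
    fix r s assume "r \<in> I" "s \<in> I" "r < s"
    then show "\<phi> (r - c) < \<phi> (s - c)" using J' by (intro strict_mono_onD[OF *(2)]) auto
  qed
  moreover have "(\<lambda>s. \<phi> (s - c)) ` I \<subseteq> K" using *(3) J' by (simp add: image_subset_iff)
  moreover have "\<forall>s\<in>I. \<phi> (s - c) < t" "\<forall>s\<in>I. \<gamma>' (\<phi> (s - c)) = \<gamma> s" using *(5,7) J' \<sigma> by simp_all
  ultimately show "future_extendible l crv I \<gamma>"
    unfolding future_extendible_iff[OF I] using *(4,6)
    by (intro exI[of _ "\<lambda>s. \<phi> (s - c)"] exI[of _ K] exI[of _ \<gamma>'] exI[of _ t]) simp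
qed

lemma future_cauchy_complete_shift:
  assumes \<gamma>: "future_cauchy_complete l crv I \<gamma>"
  shows "future_cauchy_complete l crv ((\<lambda>t. t + c) -` I) (\<lambda>t. \<gamma> (t + c))"
proof -
  define J where "J = (\<lambda>t. t + c) -` I"
  define \<sigma> where "\<sigma> t = \<gamma> (t + c)" for t
  have \<gamma>': "timelike_curve l crv I \<gamma>" "\<not> future_extendible l crv I \<gamma>"
    using \<gamma> unfolding future_cauchy_complete_iff by auto
  have J: "s \<in> J \<longleftrightarrow> s + c \<in> I" for s by (simp add: J_def)
  have \<sigma>: "timelike_curve l crv J \<sigma>"
    using timelike_affine[OF zero_less_one \<gamma>'(1), of c] unfolding J_def \<sigma>_def by simp
  have "\<not> future_extendible l crv J \<sigma>"
    using future_extendible_shift[where c = c and \<gamma> = \<gamma>, OF timelike_interval(1)[OF \<gamma>'(1)] timelike_interval(1)[OF \<sigma>] J \<sigma>_def] \<gamma>'(2)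
    by blast
  moreover have "\<exists>m\<in>J. \<forall>t\<in>J. t \<le> m"
    if t0: "t0 \<in> J" "\<And>t. t \<in> J \<Longrightarrow> t0 \<le> t \<Longrightarrow> ldist l (\<sigma> t0) (\<sigma> t) \<le> ereal C" for t0 C
  proof -
    have "ldist l (\<gamma> (t0 + c)) (\<gamma> t) \<le> ereal C" if "t \<in> I" "t0 + c \<le> t" for t
      using t0(2)[of "t - c"] that by (simp add: J \<sigma>_def)
    then obtain m where m: "m \<in> I" "\<And>t. t \<in> I \<Longrightarrow> t \<le> m"
      using \<gamma> t0(1) unfolding future_cauchy_complete_iff J by blast
    have "t \<le> m - c" if "t \<in> J" for t using m(2)[of "t + c"] that J by auto
    moreover have "m - c \<in> J" using m(1) by (simp add: J)
    ultimately show ?thesis by blast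
  qed
  ultimately have "future_cauchy_complete l crv J \<sigma>"
    unfolding future_cauchy_complete_iff using \<sigma> by blast
  then show ?thesis unfolding J_def \<sigma>_def by simp
qed

lemma past_cauchy_complete_iff:
  "past_cauchy_complete l crv I \<gamma> \<longleftrightarrow> timelike_curve l crv I \<gamma> \<and> \<not> past_extendible l crv I \<gamma> \<and>
     ((\<exists>t0\<in>I. \<exists>C::real. \<forall>t \<in> I. t \<le> t0 \<longrightarrow> ldist l (\<gamma> t) (\<gamma> t0) \<le> ereal C) \<longrightarrow> (\<exists>m\<in>I. \<forall>t\<in>I. m \<le> t))"
proof -
  have "bdd_below I \<and> Inf I \<in> I \<longleftrightarrow> (\<exists>m\<in>I. \<forall>t\<in>I. m \<le> t)" if I: "I \<noteq> {}"
  proof -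
    \<comment> \<open>On the reals \<open>Inf\<close> is by definition the negative of the supremum
      of the reflected set.\<close>
    have "bdd_below I \<and> Inf I \<in> I \<longleftrightarrow> bdd_above (uminus ` I) \<and> Sup (uminus ` I) \<in> uminus ` I"
      by (auto simp: Inf_real_def bdd_above_uminus image_iff) force
    also have "\<dots> \<longleftrightarrow> (\<exists>m\<in>I. \<forall>t\<in>I. m \<le> t)"
      using I by (subst Sup_mem_iff) auto
    finally show ?thesis .
  qed
  moreover have "(\<forall>t \<in> {..t0} \<inter> I. ldist l (\<gamma> t) (\<gamma> t0) \<le> ereal C) \<longleftrightarrow>
      (\<forall>t \<in> I. t \<le> t0 \<longrightarrow> ldist l (\<gamma> t) (\<gamma> t0) \<le> ereal C)" for t0 C by auto
  ultimately show ?thesis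
    unfolding past_cauchy_complete_def past_inextendible_timelike_def
    using timelike_interval(2)[of I \<gamma>]
    by (cases "timelike_curve l crv I \<gamma>") simp_all
qed

section \<open>Past notions through time reversal\<close>

lemma ldist_dual: "ldist (\<lambda>x y. l y x) x y = ldist l y x"
  by (simp add: ldist_def)

text \<open>The two implications are the same reflection, carried out once for \<open>l\<close> and
  once in the dual space; reflecting twice gives back the curve.\<close>

lemma past_extendible_iff_dual:
  "past_extendible l crv I \<gamma> \<longleftrightarrow> future_extendible (\<lambda>x y. l y x) crv (uminus ` I) (\<lambda>t. \<gamma> (- t))"
proof
  interpret D: finite_time_separation crv "\<lambda>x y. l y x" by (rule dual)
  show "past_extendible l crv I \<gamma>" if "future_extendible (\<lambda>x y. l y x) crv (uminus ` I) (\<lambda>t. \<gamma> (- t))"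
    using D.future_extendible_dual[OF that] by simp
qed (rule past_extendible_dual)

lemma timelike_iff_dual:
  "timelike_curve l crv I \<gamma> \<longleftrightarrow> timelike_curve (\<lambda>x y. l y x) crv (uminus ` I) (\<lambda>t. \<gamma> (- t))"
proof
  interpret D: finite_time_separation crv "\<lambda>x y. l y x" by (rule dual)
  show "timelike_curve l crv I \<gamma>" if "timelike_curve (\<lambda>x y. l y x) crv (uminus ` I) (\<lambda>t. \<gamma> (- t))"
    using D.timelike_dual[OF that] by simp
qed (rule timelike_dual)

lemma past_cauchy_complete_iff_dual:
  "past_cauchy_complete l crv I \<gamma> \<longleftrightarrow> future_cauchy_complete (\<lambda>x y. l y x) crv (uminus ` I) (\<lambda>t. \<gamma> (- t))"
proof -
  interpret D: finite_time_separation crv "\<lambda>x y. l y x" by (rule dual)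
  show ?thesis
    unfolding past_cauchy_complete_iff D.future_cauchy_complete_iff
    by (simp add: ldist_dual timelike_iff_dual past_extendible_iff_dual)
qed

lemma past_inextendible_iff_dual:
  "past_inextendible_timelike l crv I \<gamma> \<longleftrightarrow>
    future_inextendible_timelike (\<lambda>x y. l y x) crv (uminus ` I) (\<lambda>t. \<gamma> (- t))"
  unfolding past_inextendible_timelike_def future_inextendible_timelike_def
  by (simp add: timelike_iff_dual past_extendible_iff_dual)

lemma past_cauchy_complete_tail:
  assumes \<gamma>: "past_cauchy_complete l crv I \<gamma>" and \<sigma>: "timelike_curve l crv J \<sigma>"
    and c: "c \<in> I" and tail: "I \<inter> {..c} = J \<inter> {..c}" "\<And>t. t \<in> I \<Longrightarrow> t \<le> c \<Longrightarrow> \<gamma> t = \<sigma> t"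
  shows "past_cauchy_complete l crv J \<sigma>"
proof -
  interpret D: finite_time_separation crv "\<lambda>x y. l y x" by (rule dual)
  have "future_cauchy_complete (\<lambda>x y. l y x) crv (uminus ` J) (\<lambda>t. \<sigma> (- t))"
  proof (rule D.future_cauchy_complete_tail[of "uminus ` I" "\<lambda>t. \<gamma> (- t)" _ _ "- c"])
    have "uminus ` I \<inter> {- c..} = uminus ` (I \<inter> {..c})" for I by auto
    then show "uminus ` I \<inter> {- c..} = uminus ` J \<inter> {- c..}" using tail(1) by simp
  qed (use \<gamma> timelike_dual[OF \<sigma>] c tail(2) in \<open>auto simp: past_cauchy_complete_iff_dual\<close>)
  then show ?thesis by (simp add: past_cauchy_complete_iff_dual)
qed

section \<open>Joining half-curves to Cauchy complete curves\<close>

lemma cauchy_complete_iff: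
  "cauchy_complete_timelike l crv I \<gamma> \<longleftrightarrow> future_cauchy_complete l crv I \<gamma> \<and> past_cauchy_complete l crv I \<gamma>"
  unfolding cauchy_complete_timelike_def inextendible_timelike_def future_cauchy_complete_def
    past_cauchy_complete_def
  by (rule iffI; elim conjE; intro conjI; assumption)

lemma cauchy_complete_timelike_curve: "cauchy_complete_timelike l crv I \<gamma> \<Longrightarrow> timelike_curve l crv I \<gamma>"
  unfolding cauchy_complete_iff future_cauchy_complete_iff by blast

lemma future_cauchy_complete_join:
  assumes \<gamma>: "timelike_curve l crv I \<gamma>" and \<sigma>: "future_cauchy_complete l crv J \<sigma>"
    and c: "c \<in> I" "c \<in> J" "\<gamma> c = \<sigma> c"
  shows "future_cauchy_complete l crv (join_dom I c J) (join \<gamma> c \<sigma>)"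
proof (rule future_cauchy_complete_tail[OF \<sigma> _ c(2)])
  show "timelike_curve l crv (join_dom I c J) (join \<gamma> c \<sigma>)"
    by (rule timelike_join) (use \<gamma> \<sigma> c in \<open>simp_all add: future_cauchy_complete_iff\<close>)
  show "J \<inter> {c..} = join_dom I c J \<inter> {c..}" using c by auto
  show "\<sigma> t = join \<gamma> c \<sigma> t" if "t \<in> J" "c \<le> t" for t using that c(3) by auto
qed

lemma past_cauchy_complete_join:
  assumes \<gamma>: "past_cauchy_complete l crv I \<gamma>" and \<sigma>: "timelike_curve l crv J \<sigma>"
    and c: "c \<in> I" "c \<in> J" "\<gamma> c = \<sigma> c"
  shows "past_cauchy_complete l crv (join_dom I c J) (join \<gamma> c \<sigma>)"
proof (rule past_cauchy_complete_tail[OF \<gamma> _ c(1)])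
  show "timelike_curve l crv (join_dom I c J) (join \<gamma> c \<sigma>)"
    by (rule timelike_join) (use \<gamma> \<sigma> c in \<open>simp_all add: past_cauchy_complete_iff\<close>)
  show "I \<inter> {..c} = join_dom I c J \<inter> {..c}" using c by auto
qed simp

text \<open>The second curve is shifted so that its parameter \<open>d\<close> falls on
  \<open>c\<close>. The last conclusion tells at which parameters of the joined curve the points of
  \<open>\<sigma>\<close> from \<open>d\<close> on are found, so that prescribed points can be
  located on it.\<close>

lemma cauchy_complete_join:
  assumes \<gamma>: "past_cauchy_complete l crv I \<gamma>" and \<sigma>: "future_cauchy_complete l crv J \<sigma>"
    and c: "c \<in> I" "d \<in> J" "\<gamma> c = \<sigma> d"
  obtains K \<kappa> where "cauchy_complete_timelike l crv K \<kappa>"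
    "\<And>t. t \<in> J \<Longrightarrow> d \<le> t \<Longrightarrow> t - d + c \<in> K \<and> \<kappa> (t - d + c) = \<sigma> t"
proof -
  define J' where "J' = (\<lambda>t. t + (d - c)) -` J"
  define \<sigma>' where "\<sigma>' t = \<sigma> (t + (d - c))" for t
  have \<sigma>': "future_cauchy_complete l crv J' \<sigma>'"
    unfolding J'_def \<sigma>'_def by (rule future_cauchy_complete_shift[OF \<sigma>])
  have c': "c \<in> J'" "\<gamma> c = \<sigma>' c" using c by (simp_all add: J'_def \<sigma>'_def)
  have tl: "timelike_curve l crv I \<gamma>" "timelike_curve l crv J' \<sigma>'"
    using \<gamma> \<sigma>' unfolding past_cauchy_complete_iff future_cauchy_complete_iff by blast+
  show thesis
  proof (rule that)
    show "cauchy_complete_timelike l crv (join_dom I c J') (join \<gamma> c \<sigma>')"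
      unfolding cauchy_complete_iff
      using future_cauchy_complete_join[OF tl(1) \<sigma>' c(1) c'] past_cauchy_complete_join[OF \<gamma> tl(2) c(1) c']
      by blast
    show "t - d + c \<in> join_dom I c J' \<and> join \<gamma> c \<sigma>' (t - d + c) = \<sigma> t" if "t \<in> J" "d \<le> t" for t
      using that c by (auto simp: J'_def \<sigma>'_def)
  qed
qed

lemma timelike_path:
  assumes tpc: "timelike_path_connected l crv" and xy: "chron_less l x y" and ab: "a < b"
  obtains \<gamma> where "timelike_curve l crv {a..b} \<gamma>" "\<gamma> a = x" "\<gamma> b = y"
proof -
  obtain c d \<sigma> where \<sigma>: "c \<le> d" "timelike_curve l crv {c..d} \<sigma>" "\<sigma> c = x" "\<sigma> d = y"
    using tpc xy unfolding timelike_path_connected_def by blast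
  have "c \<noteq> d" using xy \<sigma> by auto
  \<comment> \<open>The affine map with slope \<open>m\<close> takes \<open>a\<close> to
    \<open>c\<close> and \<open>b\<close> to \<open>d\<close>. It is increasing, because
    \<open>c = d\<close> would give \<open>x = y\<close>, against irreflexivity.\<close>
  define m where "m = (d - c) / (b - a)"
  have m: "m > 0" using \<open>c \<noteq> d\<close> \<sigma>(1) ab by (simp add: m_def)
  have mb: "m * (b - a) = d - c" using ab by (simp add: m_def)
  then have b: "m * b + (c - m * a) = d" by (simp add: algebra_simps)
  have "(m * t + (c - m * a) \<in> {c..d}) = (t \<in> {a..b})" for t
  proof -
    have "m * t + (c - m * a) = c + m * (t - a)" "d = c + m * (b - a)" using mb by (simp_all add: algebra_simps)
    then show ?thesis using m by (simp add: zero_le_mult_iff)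
  qed
  then have "(\<lambda>t. m * t + (c - m * a)) -` {c..d} = {a..b}" by blast
  then have "timelike_curve l crv {a..b} (\<lambda>t. \<sigma> (m * t + (c - m * a)))"
    using timelike_affine[OF m \<sigma>(2), of "c - m * a"] by simp
  then show thesis by (rule that) (simp_all add: b \<sigma>)
qed

lemma cauchy_complete_through_two_points:
  assumes tpc: "timelike_path_connected l crv"
    and ex: "\<forall>x. \<exists>I \<gamma>. cauchy_complete_timelike l crv I \<gamma> \<and> x \<in> \<gamma> ` I"
    and xy: "chron_less l x y"
  obtains I \<gamma> s t where "cauchy_complete_timelike l crv I \<gamma>" "s \<in> I" "t \<in> I" "\<gamma> s = x" "\<gamma> t = y"
proof -
  obtain I \<gamma> c where \<gamma>: "cauchy_complete_timelike l crv I \<gamma>" "c \<in> I" "\<gamma> c = x"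
    using ex[rule_format, of x] by (elim exE conjE imageE) (rule that; simp)
  obtain J \<sigma> d where \<sigma>: "cauchy_complete_timelike l crv J \<sigma>" "d \<in> J" "\<sigma> d = y"
    using ex[rule_format, of y] by (elim exE conjE imageE) (rule that; simp)
  \<comment> \<open>The segment from \<open>x\<close> to \<open>y\<close> is parametrised so as to
    arrive at the parameter \<open>d\<close> at which \<open>\<sigma>\<close> passes through
    \<open>y\<close>; its length 1 is an arbitrary choice.\<close>
  obtain \<rho> where \<rho>: "timelike_curve l crv {d - 1..d} \<rho>" "\<rho> (d - 1) = x" "\<rho> d = y"
    by (rule timelike_path[OF tpc xy, of "d - 1" d]) auto
  have fut: "future_cauchy_complete l crv (join_dom {d - 1..d} d J) (join \<rho> d \<sigma>)"
    by (rule future_cauchy_complete_join) (use \<rho> \<sigma> cauchy_complete_iff in auto)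
  have past: "past_cauchy_complete l crv I \<gamma>" using \<gamma>(1) cauchy_complete_iff by blast
  obtain K \<kappa> where K: "cauchy_complete_timelike l crv K \<kappa>"
    "\<And>t. t \<in> join_dom {d - 1..d} d J \<Longrightarrow> d - 1 \<le> t \<Longrightarrow> t - (d - 1) + c \<in> K \<and> \<kappa> (t - (d - 1) + c) = join \<rho> d \<sigma> t"
    by (rule cauchy_complete_join[OF past fut \<gamma>(2), of "d - 1"]) (use \<rho> \<gamma> in auto)
  \<comment> \<open>On the joined curve \<open>x\<close> sits at the parameter \<open>c\<close> and
    \<open>y\<close> at \<open>c + 1\<close>.\<close>
  show thesis
    using that[OF K(1), of "d - 1 - (d - 1) + c" "d - (d - 1) + c"] K(2)[of "d - 1"] K(2)[of d] \<rho> \<sigma> by auto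
qed

text \<open>An extension beyond the last parameter would remain in
  \<open>J_future l (\<gamma> b)\<close> and hence be constant on a nondegenerate interval, which is
  excluded for causal curves.\<close>

lemma future_inextendible_of_maximum:
  assumes \<gamma>: "timelike_curve l crv I \<gamma>" and b: "b \<in> I" "\<And>t. t \<in> I \<Longrightarrow> t \<le> b" and J: "J_future l (\<gamma> b) = {\<gamma> b}"
  shows "future_inextendible_timelike l crv I \<gamma>"
proof -
  have False if ext: "future_extendible l crv I \<gamma>"
  proof -
    obtain \<phi> J \<gamma>' t where "continuous_on I \<phi>" "strict_mono_on I \<phi>" and *: "\<phi> ` I \<subseteq> J" "t \<in> J" "\<forall>s\<in>I. \<phi> s < t"
         "causal_curve l crv J \<gamma>'" "\<forall>s\<in>I. \<gamma>' (\<phi> s) = \<gamma> s"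
      using ext unfolding future_extendible_iff[OF timelike_interval(1)[OF \<gamma>]] by blast
    have J: "is_interval J" using *(4) crv_interval(1)[of J \<gamma>'] by (simp add: causal_curve_def)
    have \<phi>b: "\<phi> b \<in> J" "\<phi> b < t" using *(1,3) b(1) by (simp_all add: image_subset_iff)
    have "\<gamma>' s = \<gamma> b" if s: "s \<in> {\<phi> b..t}" for s
    proof -
      have "s \<in> J" by (rule mem_is_interval_1_I[OF J \<phi>b(1) *(2)]) (use s in auto)
      then have "causal_le l (\<gamma>' (\<phi> b)) (\<gamma>' s)"
        using *(4) \<phi>b(1) s unfolding causal_curve_def by (cases "s = \<phi> b") auto
      then have "\<gamma>' s \<in> J_future l (\<gamma> b)" using *(5) b(1) by (simp add: J_future_def)
      then show ?thesis using assms(4) by simp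
    qed
    then have "\<gamma>' constant_on {\<phi> b..t}" unfolding constant_on_def by blast
    moreover have "\<not> \<gamma>' constant_on {\<phi> b..t}"
      using *(4) \<phi>b *(2) by (simp add: causal_curve_def)
    ultimately show False by simp
  qed
  then show ?thesis unfolding future_inextendible_timelike_def using \<gamma> by blast
qed

end

section \<open>Existence of inextendible timelike curves\<close>

context finite_time_separation
begin

text \<open>A real-valued copy of the finite distance, to which linear arithmetic applies.\<close>

definition rdist :: "'a \<Rightarrow> 'a \<Rightarrow> real" where
  "rdist x y = real_of_ereal (ldist l x y)"

lemma ldist_eq_rdist: "ldist l x y = ereal (rdist x y)"
  using ldist_finite(1)[of x y] ldist_nonneg[of x y] unfolding rdist_def
  by (cases "ldist l x y") auto

lemma rdist_nonneg: "0 \<le> rdist x y"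
  using ldist_nonneg[of x y] by (simp add: ldist_eq_rdist)

lemma chron_iff_rdist: "chron_less l x y \<longleftrightarrow> 0 < rdist x y"
  by (simp add: chron_less_def ldist_eq_rdist)

lemma rdist_triangle: "causal_le l x y \<Longrightarrow> causal_le l y z \<Longrightarrow> rdist x y + rdist y z \<le> rdist x z"
  using reverse_triangle(1)[of x y z] by (simp add: ldist_eq_rdist)

text \<open>If some distance from \<open>p\<close> reaches 1, that point will do. Otherwise the
  supremum of the distances is finite, and \<open>q\<close> makes it positive, so that some point
  lies beyond half of it.\<close>

lemma exists_far_successor:
  assumes "chron_less l p q"
  obtains r where "chron_less l p r" "\<And>r'. min 1 (rdist p r' / 2) \<le> rdist p r"
proof (cases "\<exists>r. rdist p r \<ge> 1")
  case True
  then obtain r where r: "rdist p r \<ge> 1" by blast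
  show thesis by (rule that[of r]) (use r in \<open>auto simp: chron_iff_rdist\<close>)
next
  case False
  then have bdd: "bdd_above (range (rdist p))" by (force simp: bdd_above_def not_le intro: less_imp_le)
  define s where "s = Sup (range (rdist p))"
  have le: "rdist p r \<le> s" for r unfolding s_def by (rule cSup_upper[OF _ bdd]) simp
  have "0 < s" using le[of q] assms unfolding chron_iff_rdist by linarith
  then have "s / 2 < Sup (range (rdist p))" unfolding s_def by simp
  then obtain r where r: "s / 2 < rdist p r" using less_cSup_iff[OF _ bdd] by blast
  show thesis
  proof (rule that[of r])
    show "chron_less l p r" using r \<open>0 < s\<close> by (simp add: chron_iff_rdist)
    show "min 1 (rdist p r' / 2) \<le> rdist p r" for r' using r le[of r'] by linarith
  qed
qed

lemma timelike_cong:
  assumes "timelike_curve l crv I \<gamma>" "\<And>t. t \<in> I \<Longrightarrow> \<gamma> t = \<sigma> t"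
  shows "timelike_curve l crv I \<sigma>"
  using assms(1) crv_cong[of I \<gamma> \<sigma>] assms(2) unfolding timelike_curve_def by simp

lemma timelike_sing: "timelike_curve l crv {a} \<gamma>"
  using crv_sing by (simp add: timelike_curve_def)

text \<open>One timelike segment is chosen between any two consecutive integers. Concatenation makes
  the curve timelike on every \<open>{0..real n}\<close> by induction, and \<open>crv_ray\<close>
  passes to the half-line.\<close>

lemma timelike_ray_through_sequence:
  assumes tpc: "timelike_path_connected l crv" and p: "\<And>n. chron_less l (p n) (p (Suc n))"
  obtains \<gamma> where "timelike_curve l crv {0..} \<gamma>" "\<And>n. \<gamma> (real n) = p n"
proof -
  have "\<exists>g. timelike_curve l crv {real n..real (Suc n)} g \<and> g (real n) = p n \<and> g (real (Suc n)) = p (Suc n)" for n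
    by (rule timelike_path[OF tpc p, of "real n" "real (Suc n)"]) auto
  then obtain g where g: "\<And>n. timelike_curve l crv {real n..real (Suc n)} (g n)"
    "\<And>n. g n (real n) = p n" "\<And>n. g n (real (Suc n)) = p (Suc n)" by metis
  define \<gamma> where "\<gamma> t = g (nat \<lfloor>t\<rfloor>) t" for t
  have \<gamma>p: "\<gamma> (real n) = p n" for n by (simp add: \<gamma>_def g(2))
  \<comment> \<open>At the right end the floor already selects the next segment, which takes the
    same value there.\<close>
  have \<gamma>g: "\<gamma> t = g n t" if "real n < t" "t \<le> real (Suc n)" for n t
  proof (cases "t = real (Suc n)")
    case True
    then show ?thesis using \<gamma>p[of "Suc n"] g(3)[of n] by simp
  next
    case False
    then have "\<lfloor>t\<rfloor> = int n" using that by (intro floor_unique) auto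
    then show ?thesis by (simp add: \<gamma>_def)
  qed
  have tl: "timelike_curve l crv {0..real n} \<gamma>" for n
  proof (induction n)
    case 0
    then show ?case by (simp add: timelike_sing)
  next
    case (Suc n)
    have "timelike_curve l crv (join_dom {0..real n} (real n) {real n..real (Suc n)}) (join \<gamma> (real n) (g n))"
      by (rule timelike_join[OF Suc g(1)]) (auto simp: \<gamma>p g(2))
    moreover have "join_dom {0..real n} (real n) {real n..real (Suc n)} = {0..real (Suc n)}" by auto
    ultimately have "timelike_curve l crv {0..real (Suc n)} (join \<gamma> (real n) (g n))" by simp
    then show ?case by (rule timelike_cong) (use \<gamma>g[where n = n] in auto)
  qed
  have "timelike_curve l crv {0..} \<gamma>"
    unfolding timelike_curve_def
  proof (intro conjI ballI impI)
    show "crv {0..} \<gamma>" by (rule crv_ray) (use tl in \<open>simp add: timelike_curve_def\<close>)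
    fix t s :: real assume ts: "t \<in> {0..}" "s \<in> {0..}" "t < s"
    obtain n where "s < real n" using reals_Archimedean2 by blast
    then show "chron_less l (\<gamma> t) (\<gamma> s)" using timelike_less[OF tl, of t n s] ts by simp
  qed
  then show thesis using that \<gamma>p by blast
qed

text \<open>
  A timelike curve that at each step moves at least half as far as is possible, or a unit, cannot
  converge to a point with nonempty future: the steps would be bounded below.
\<close>

lemma exists_future_inextendible:
  assumes tpc: "timelike_path_connected l crv"
    and bubbling: "\<And>q. I_future l q = {} \<Longrightarrow> J_future l q = {q}"
  obtains I \<gamma> where "future_inextendible_timelike l crv I \<gamma>" "0 \<in> I" "\<gamma> 0 = x"
\<comment> \<open>If a point without chronological future can be reached, the curve ends there: by
  the hypothesis on the bubbling boundary it cannot be continued even causally.\<close>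
proof (cases "\<exists>q. (q = x \<or> chron_less l x q) \<and> I_future l q = {}")
  case True
  then obtain q where q: "q = x \<or> chron_less l x q" "I_future l q = {}" by blast
  have J: "J_future l q = {q}" using bubbling q by blast
  show thesis
  proof (cases "q = x")
    case True
    show thesis
      by (rule that[of "{0}" "\<lambda>_. x"], rule future_inextendible_of_maximum[OF timelike_sing, of 0])
        (use J True in auto)
  next
    case False
    then obtain \<gamma> where \<gamma>: "timelike_curve l crv {0..1} \<gamma>" "\<gamma> 0 = x" "\<gamma> 1 = q"
      using timelike_path[OF tpc, of x q 0 1] q by auto
    show thesis
      by (rule that[of "{0..1}" \<gamma>], rule future_inextendible_of_maximum[OF \<gamma>(1), of 1])
        (use J \<gamma> in auto)
  qed
next
  case False
  then have ne: "\<exists>r. chron_less l q r" if "q = x \<or> chron_less l x q" for q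
    using that by (auto simp: I_future_def)
  \<comment> \<open>The clause for \<open>n = 0\<close> fixes the starting point in the dependent
    choice; the other clause keeps every point among those that have a chronological
    successor.\<close>
  define P where "P n q \<longleftrightarrow> (q = x \<or> chron_less l x q) \<and> (n = 0 \<longrightarrow> q = x)" for n :: nat and q
  define Q where "Q q r \<longleftrightarrow> chron_less l q r \<and> (\<forall>r'. min 1 (rdist q r' / 2) \<le> rdist q r)" for q r
  have "\<exists>p. \<forall>n. P n (p n) \<and> Q (p n) (p (Suc n))"
  proof (rule dependent_nat_choice)
    show "\<exists>q. P 0 q" by (simp add: P_def)
    fix q n assume q: "P n q"
    then obtain r where r: "chron_less l q r" using ne unfolding P_def by blast
    obtain r where r: "Q q r" using exists_far_successor[OF r] unfolding Q_def by blast
    moreover have "chron_less l x r" using q r chron_trans unfolding P_def Q_def by blast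
    ultimately show "\<exists>r. P (Suc n) r \<and> Q q r" unfolding P_def by blast
  qed
  then obtain p where p: "\<And>n. P n (p n)" "\<And>n. Q (p n) (p (Suc n))" by blast
  have p0: "p 0 = x" using p(1)[of 0] by (simp add: P_def)
  have step: "chron_less l (p n) (p (Suc n))" for n using p(2) by (simp add: Q_def)
  obtain \<gamma> where \<gamma>: "timelike_curve l crv {0..} \<gamma>" "\<And>n. \<gamma> (real n) = p n"
    using timelike_ray_through_sequence[where p = p, OF tpc step] by blast
  have False if ext: "future_extendible l crv {0..} \<gamma>"
  proof -
    obtain \<phi> J \<gamma>' t where "continuous_on {0..} \<phi>" "strict_mono_on {0..} \<phi>" and *: "\<phi> ` {0..} \<subseteq> J" "t \<in> J"
      "\<forall>s\<in>{0..}. \<phi> s < t" "causal_curve l crv J \<gamma>'" "\<forall>s\<in>{0..}. \<gamma>' (\<phi> s) = \<gamma> s"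
      using ext unfolding future_extendible_iff[OF timelike_interval(1)[OF \<gamma>(1)]] by blast
    \<comment> \<open>The point of a hypothetical extension at the parameter \<open>t\<close> beyond
      the curve; every \<open>p n\<close> precedes it causally.\<close>
    define q where "q = \<gamma>' t"
    have pq: "causal_le l (p n) q" for n
    proof -
      have "\<phi> (real n) \<in> J" "\<phi> (real n) < t" using *(1,3) by (auto simp: image_subset_iff)
      moreover have "\<gamma>' (\<phi> (real n)) = p n" using *(5) \<gamma>(2) by simp
      ultimately show ?thesis using *(2,4) unfolding causal_curve_def q_def by metis
    qed
    have "chron_less l x q" using chron_causal_trans[OF step pq, of 0] p0 by simp
    then obtain r where r: "chron_less l q r" using ne by blast
    \<comment> \<open>The point \<open>r\<close> is also a successor of every \<open>p n\<close>, at
      a distance no smaller than that from \<open>q\<close>; the greedy choice therefore makes every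
      step at least \<open>c\<close> long.\<close>
    define c where "c = min 1 (rdist q r / 2)"
    have c: "c > 0" using r by (simp add: c_def chron_iff_rdist)
    have far: "c \<le> rdist (p n) (p (Suc n))" for n
    proof -
      have "rdist q r \<le> rdist (p n) r"
        using rdist_triangle[OF pq chron_imp_causal[OF r], of n] rdist_nonneg[of "p n" q] by linarith
      moreover have "min 1 (rdist (p n) r / 2) \<le> rdist (p n) (p (Suc n))" using p(2) by (simp add: Q_def)
      ultimately show ?thesis unfolding c_def by linarith
    qed
    \<comment> \<open>The steps add up by the reverse triangle inequality, so the distance from
      \<open>p 0\<close> to \<open>p n\<close> outgrows the finite distance from \<open>p 0\<close>
      to \<open>q\<close>, although \<open>p n\<close> precedes \<open>q\<close>.\<close>
    have grow: "causal_le l (p 0) (p n) \<and> real n * c \<le> rdist (p 0) (p n)" for n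
    proof (induction n)
      case 0
      then show ?case by (simp add: rdist_nonneg)
    next
      case (Suc n)
      have "causal_le l (p n) (p (Suc n))" using step chron_imp_causal by blast
      then have "causal_le l (p 0) (p (Suc n))" "rdist (p 0) (p n) + rdist (p n) (p (Suc n)) \<le> rdist (p 0) (p (Suc n))"
        using Suc reverse_triangle(2) rdist_triangle by blast+
      then show ?case using Suc far[of n] by (simp add: algebra_simps)
    qed
    obtain n where "rdist (p 0) q < real n * c" using ex_less_of_nat_mult[OF c] by blast
    moreover have "rdist (p 0) (p n) \<le> rdist (p 0) q"
      using rdist_triangle[of "p 0" "p n" q] grow[of n] pq[of n] rdist_nonneg[of "p n" q] by simp
    ultimately show False using grow[of n] by linarith
  qed
  then show thesis
    using that[of "{0..}" \<gamma>] \<gamma>(1) \<gamma>(2)[of 0] p0 by (auto simp: future_inextendible_timelike_def)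
qed

lemma timelike_path_connected_dual:
  assumes tpc: "timelike_path_connected l crv"
  shows "timelike_path_connected (\<lambda>x y. l y x) crv"
  unfolding timelike_path_connected_def
proof (intro allI impI)
  fix x y assume "chron_less (\<lambda>x y. l y x) x y"
  then have "chron_less l y x" by (simp add: chron_less_def ldist_def)
  then obtain \<gamma> where \<gamma>: "timelike_curve l crv {0..1} \<gamma>" "\<gamma> 0 = y" "\<gamma> 1 = x"
    using timelike_path[OF tpc, of y x 0 1] by auto
  have "timelike_curve (\<lambda>x y. l y x) crv {- 1..0} (\<lambda>t. \<gamma> (- t))"
    using timelike_dual[OF \<gamma>(1)] by simp
  then show "\<exists>a b \<gamma>. a \<le> b \<and> timelike_curve (\<lambda>x y. l y x) crv {a..b} \<gamma> \<and> \<gamma> a = x \<and> \<gamma> b = y"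
    using \<gamma>(2,3) by (intro exI[of _ "- 1"] exI[of _ 0] exI[of _ "\<lambda>t. \<gamma> (- t)"]) simp
qed

lemma exists_past_inextendible:
  assumes tpc: "timelike_path_connected l crv"
    and bubbling: "\<And>q. I_past l q = {} \<Longrightarrow> J_past l q = {q}"
  obtains I \<gamma> where "past_inextendible_timelike l crv I \<gamma>" "0 \<in> I" "\<gamma> 0 = x"
proof -
  interpret D: finite_time_separation crv "\<lambda>x y. l y x" by (rule dual)
  have bub: "J_future (\<lambda>x y. l y x) q = {q}" if "I_future (\<lambda>x y. l y x) q = {}" for q
    using bubbling[of q] that
    by (simp add: J_future_def I_future_def J_past_def I_past_def causal_le_def chron_less_def ldist_def)
  obtain I \<gamma> where "future_inextendible_timelike (\<lambda>x y. l y x) crv I \<gamma>" "0 \<in> I" "\<gamma> 0 = x"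
    by (rule D.exists_future_inextendible[OF timelike_path_connected_dual[OF tpc] bub, of x])
  then show thesis
    using that[of "uminus ` I" "\<lambda>t. \<gamma> (- t)"] by (simp add: past_inextendible_iff_dual image_iff)
qed

text \<open>Two curves through \<open>x\<close> are available, one inextendible to the past and one
  to the future. Condition B makes each Cauchy complete in its direction, and they are joined at
  \<open>x\<close>.\<close>

lemma condition_B_exists_cauchy_complete:
  assumes tpc: "timelike_path_connected l crv" and bubbling: "empty_bubbling_boundary l"
    and B: "condition_B l crv"
  shows "\<exists>I \<gamma>. cauchy_complete_timelike l crv I \<gamma> \<and> x \<in> \<gamma> ` I"
proof -
  have bub: "I_future l q = {} \<Longrightarrow> J_future l q = {q}" "I_past l q = {} \<Longrightarrow> J_past l q = {q}" for q
  proof -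
    have "q \<in> {x. J_future l x = {x}} \<longleftrightarrow> q \<in> {x. I_future l x = {}}"
      "q \<in> {x. J_past l x = {x}} \<longleftrightarrow> q \<in> {x. I_past l x = {}}"
      using bubbling unfolding empty_bubbling_boundary_def by (simp_all only:)
    then show "I_future l q = {} \<Longrightarrow> J_future l q = {q}" "I_past l q = {} \<Longrightarrow> J_past l q = {q}"
      by (simp_all only: mem_Collect_eq)
  qed
  obtain I \<gamma> where \<gamma>: "past_inextendible_timelike l crv I \<gamma>" "0 \<in> I" "\<gamma> 0 = x"
    by (rule exists_past_inextendible[OF tpc bub(2), of x])
  obtain J \<sigma> where \<sigma>: "future_inextendible_timelike l crv J \<sigma>" "0 \<in> J" "\<sigma> 0 = x"
    by (rule exists_future_inextendible[OF tpc bub(1), of x])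
  have "past_cauchy_complete l crv I \<gamma>" "future_cauchy_complete l crv J \<sigma>"
    using B \<gamma> \<sigma> unfolding condition_B_def by simp_all
  then obtain K \<kappa> where "cauchy_complete_timelike l crv K \<kappa>"
    "\<And>t. t \<in> J \<Longrightarrow> 0 \<le> t \<Longrightarrow> t - 0 + 0 \<in> K \<and> \<kappa> (t - 0 + 0) = \<sigma> t"
    by (rule cauchy_complete_join[of I \<gamma> J \<sigma> 0 0]) (use \<gamma> \<sigma> in auto)
  then show ?thesis using \<sigma>(2,3) by (intro exI[of _ K] exI[of _ \<kappa>]) force
qed

end

section \<open>The metric on weak Cauchy sets\<close>

text \<open>The existence of Cauchy complete curves is an assumption here: it is given in one part
  of the theorem and derived from Condition B in the other.\<close>

locale cauchy_complete_space = finite_time_separation +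
  assumes open_I: "open (I_future l x)" "open (I_past l x)"
    and tpc: "timelike_path_connected l crv"
    and geodesic: "geodesic_space l crv"
    and cont: "continuous_ldist l"
    and exists_cauchy_complete: "\<And>x. \<exists>I \<gamma>. cauchy_complete_timelike l crv I \<gamma> \<and> x \<in> \<gamma> ` I"
begin

section \<open>Weak Cauchy sets are achronal and separate past from future\<close>

lemma cauchy_complete_through:
  obtains I \<gamma> t where "cauchy_complete_timelike l crv I \<gamma>" "t \<in> I" "\<gamma> t = x"
  using exists_cauchy_complete[of x] by (elim exE conjE imageE) (rule that; simp)

lemma weak_cauchy_meets:
  assumes "A \<in> weak_cauchy_sets l crv" "cauchy_complete_timelike l crv I \<gamma>"
  obtains t where "t \<in> I" "\<gamma> t \<in> A"
proof -
  have "\<exists>!t. t \<in> I \<and> \<gamma> t \<in> A" using assms unfolding weak_cauchy_sets_def by simp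
  then show thesis by (elim ex1E conjE) (rule that)
qed

lemma weak_cauchy_unique:
  assumes "A \<in> weak_cauchy_sets l crv" "cauchy_complete_timelike l crv I \<gamma>"
    and "s \<in> I" "\<gamma> s \<in> A" "t \<in> I" "\<gamma> t \<in> A"
  shows "s = t"
proof -
  have "\<exists>!t. t \<in> I \<and> \<gamma> t \<in> A" using assms unfolding weak_cauchy_sets_def by simp
  then have "\<exists>\<^sub>\<le>\<^sub>1 t. t \<in> I \<and> \<gamma> t \<in> A" by (simp add: ex1_iff_ex_Uniq)
  then show ?thesis by (rule Uniq_D) (use assms(3-6) in simp_all)
qed

lemma weak_cauchy_nonempty:
  assumes A: "A \<in> weak_cauchy_sets l crv"
  shows "A \<noteq> {}"
proof -
  \<comment> \<open>Types are inhabited, so \<open>undefined\<close> is some point of the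
    space.\<close>
  obtain I \<gamma> t where \<gamma>: "cauchy_complete_timelike l crv I \<gamma>" "t \<in> I" "\<gamma> t = undefined"
    by (rule cauchy_complete_through)
  obtain s where "s \<in> I" "\<gamma> s \<in> A" by (rule weak_cauchy_meets[OF A \<gamma>(1)])
  then show ?thesis by auto
qed

lemma achronal:
  assumes A: "A \<in> weak_cauchy_sets l crv" and "x \<in> A" "y \<in> A"
  shows "\<not> chron_less l x y"
proof
  assume xy: "chron_less l x y"
  obtain I \<gamma> s t where \<gamma>: "cauchy_complete_timelike l crv I \<gamma>" "s \<in> I" "t \<in> I" "\<gamma> s = x" "\<gamma> t = y"
    by (rule cauchy_complete_through_two_points[OF tpc _ xy]) (rule allI, rule exists_cauchy_complete)
  then have "s = t" using weak_cauchy_unique[OF A \<gamma>(1), of s t] assms by simp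
  then show False using xy \<gamma> by simp
qed

text \<open>On a Cauchy complete curve through \<open>p\<close>, the parameter of \<open>p\<close>
  is compared with that of the intersection with \<open>A\<close>.\<close>

lemma weak_cauchy_cases:
  assumes A: "A \<in> weak_cauchy_sets l crv"
  obtains "p \<in> A" | a where "a \<in> A" "chron_less l a p" | a where "a \<in> A" "chron_less l p a"
proof -
  obtain I \<gamma> s where \<gamma>: "cauchy_complete_timelike l crv I \<gamma>" "s \<in> I" "\<gamma> s = p"
    by (rule cauchy_complete_through)
  obtain t where t: "t \<in> I" "\<gamma> t \<in> A" by (rule weak_cauchy_meets[OF A \<gamma>(1)])
  note tl = timelike_less[OF cauchy_complete_timelike_curve[OF \<gamma>(1)]]
  consider "s = t" | "s < t" | "t < s" by linarith
  then show thesis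
  proof cases
    case 1
    then show thesis using that(1) t \<gamma> by simp
  next
    case 2
    then show thesis using that(3)[OF t(2)] tl[of s t] t \<gamma> by simp
  next
    case 3
    then show thesis using that(2)[OF t(2)] tl[of t s] t \<gamma> by simp
  qed
qed

lemma causal_curve_crosses:
  assumes A: "A \<in> weak_cauchy_sets l crv" and \<gamma>: "causal_curve l crv {c..d} \<gamma>" and cd: "c \<le> d"
    and a: "a \<in> A" "chron_less l (\<gamma> c) a" and b: "b \<in> A" "chron_less l b (\<gamma> d)"
  shows "\<exists>s\<in>{c..d}. \<gamma> s \<in> A"
proof (rule ccontr)
  assume no: "\<not> (\<exists>s\<in>{c..d}. \<gamma> s \<in> A)"
  define U where "U = (\<Union>a\<in>A. I_future l a)"
  define V where "V = (\<Union>a\<in>A. I_past l a)"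
  have op: "open U" "open V" using open_I by (auto simp: U_def V_def)
  have "continuous_on {c..d} \<gamma>" using \<gamma> crv_interval(3)[of "{c..d}" \<gamma>] by (simp add: causal_curve_def)
  then have con: "connected (\<gamma> ` {c..d})" by (intro connected_continuous_image) auto
  have sub: "\<gamma> ` {c..d} \<subseteq> U \<union> V"
  proof
    fix p assume "p \<in> \<gamma> ` {c..d}"
    then have "p \<notin> A" using no by blast
    with weak_cauchy_cases[OF A, of p] show "p \<in> U \<union> V"
      unfolding U_def V_def I_future_def I_past_def by blast
  qed
  \<comment> \<open>A common point would lie chronologically between two points of \<open>A\<close>,
    against achronality.\<close>
  have "U \<inter> V = {}"
  proof (rule equals0I)
    fix p assume "p \<in> U \<inter> V"
    then obtain a b where "a \<in> A" "b \<in> A" "chron_less l a p" "chron_less l p b"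
      unfolding U_def V_def I_future_def I_past_def by blast
    then show False using achronal[OF A, of a b] chron_trans[of a p b] by simp
  qed
  then have "U \<inter> \<gamma> ` {c..d} = {} \<or> V \<inter> \<gamma> ` {c..d} = {}"
    using connectedD[OF con op _ sub] by blast
  moreover have "\<gamma> c \<in> V" "\<gamma> d \<in> U"
    using a b by (auto simp: U_def V_def I_future_def I_past_def)
  ultimately show False using cd by auto
qed

text \<open>A maximising causal curve from \<open>x\<close> to \<open>z\<close> meets
  \<open>A\<close> at some \<open>p\<close>. Its length is \<open>ldist l x z\<close> and, being an
  infimum over partitions, is at most the sum for the partition through \<open>p\<close>. This is
  the inequality opposite to the reverse triangle inequality.\<close>

lemma ldist_split_at_weak_cauchy:
  assumes A: "A \<in> weak_cauchy_sets l crv" and xz: "causal_le l x z"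
    and a: "a \<in> A" "chron_less l x a" and b: "b \<in> A" "chron_less l b z"
  obtains p where "p \<in> A" "ldist l x z \<le> ldist l x p + ldist l p z"
proof -
  have "\<exists>a b \<gamma>. a \<le> b \<and> causal_curve l crv {a..b} \<gamma> \<and> \<gamma> a = x \<and> \<gamma> b = z \<and> lorentz_length l a b \<gamma> = ldist l x z"
    using geodesic xz by (simp add: geodesic_space_def)
  then obtain c d \<gamma> where \<gamma>: "c \<le> d" "causal_curve l crv {c..d} \<gamma>" "\<gamma> c = x" "\<gamma> d = z"
    "lorentz_length l c d \<gamma> = ldist l x z"
    by (elim exE conjE) (rule that)
  obtain s where s: "s \<in> {c..d}" "\<gamma> s \<in> A"
    using causal_curve_crosses[OF A \<gamma>(2,1), of a b] a b \<gamma> by auto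
  \<comment> \<open>Partitions increase strictly, so \<open>s\<close> has to be interior: an end
    point in \<open>A\<close> would contradict achronality.\<close>
  have "\<gamma> c \<notin> A" "\<gamma> d \<notin> A" using achronal[OF A] a b \<gamma> by auto
  then have cd: "c < s" "s < d" using s by (auto simp: order_less_le)
  define t where "t i = (if i = 0 then c else if i = 1 then s else d)" for i :: nat
  have "(2, t) \<in> partitions c d"
    using cd by (auto simp: partitions_def chains_def t_def less_2_cases_iff)
  then have "lorentz_length l c d \<gamma> \<le> (\<Sum>i<2. ldist l (\<gamma> (t i)) (\<gamma> (t (Suc i))))"
    unfolding lorentz_length_def by (rule INF_lower2) simp
  also have "\<dots> = ldist l x (\<gamma> s) + ldist l (\<gamma> s) z"
    using \<gamma> by (simp add: t_def numeral_2_eq_2)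
  finally show thesis using that s(2) \<gamma>(5) by simp
qed

section \<open>The axioms of an extended metric\<close>

lemma ldist_le_d_J:
  assumes "x \<in> A" "y \<in> B"
  shows "ldist l x y \<le> d_J l A B" "ldist l y x \<le> d_J l A B"
proof -
  have "ldist l x y + ldist l y x \<le> d_J l A B"
    unfolding d_J_def by (rule SUP_upper2[of "(x, y)"]) (use assms in auto)
  then show "ldist l x y \<le> d_J l A B" "ldist l y x \<le> d_J l A B"
    using add_mono[of "ldist l x y" "ldist l x y" 0 "ldist l y x"]
      add_mono[of 0 "ldist l x y" "ldist l y x" "ldist l y x"] by simp_all
qed

text \<open>By asymmetry at most one of \<open>ldist l x y\<close> and \<open>ldist l y x\<close> is
  nonzero, so separate bounds on the two also bound their sum.\<close>

lemma d_J_le: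
  assumes "0 \<le> C" and le: "\<And>x y. x \<in> A \<Longrightarrow> y \<in> B \<Longrightarrow> ldist l x y \<le> C" "\<And>x y. x \<in> A \<Longrightarrow> y \<in> B \<Longrightarrow> ldist l y x \<le> C"
  shows "d_J l A B \<le> C"
  unfolding d_J_def
proof (rule SUP_least)
  fix z assume "z \<in> A \<times> B"
  then obtain x y where z: "z = (x, y)" "x \<in> A" "y \<in> B" by blast
  have "ldist l x y = 0 \<or> ldist l y x = 0" using chron_asym ldist_eq_0_iff by blast
  then have "ldist l x y + ldist l y x \<le> C" using le z by auto
  then show "(case z of (x, y) \<Rightarrow> ldist l x y + ldist l y x) \<le> C" using z by simp
qed

lemma d_J_commute: "d_J l A B = d_J l B A"
proof -
  have "d_J l A B \<le> d_J l B A" for A B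
    unfolding d_J_def by (rule SUP_least) (auto simp: add.commute intro!: SUP_upper2)
  then show ?thesis by (simp add: antisym)
qed

text \<open>If \<open>x\<close> lies on or after \<open>B\<close>, or \<open>z\<close> on or before
  it, moving this end point into \<open>B\<close> does not decrease the distance, and one summand
  suffices. Otherwise \<open>x\<close> lies before and \<open>z\<close> after \<open>B\<close>, and
  the distance is split at a point of \<open>B\<close>.\<close>

lemma ldist_le_d_J_add:
  assumes A: "A \<in> weak_cauchy_sets l crv" and B: "B \<in> weak_cauchy_sets l crv" and C: "C \<in> weak_cauchy_sets l crv"
    and x: "x \<in> A" and z: "z \<in> C"
  shows "ldist l x z \<le> d_J l A B + d_J l B C"
proof -
  have ne: "B \<noteq> {}" using weak_cauchy_nonempty B by blast
  then obtain b where b: "b \<in> B" by blast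
  have pos: "0 \<le> d_J l A B" "0 \<le> d_J l B C"
    using ldist_le_d_J(1)[OF x b] ldist_le_d_J(1)[OF b z] ldist_nonneg order_trans by blast+
  have A_le: "u \<le> d_J l A B + d_J l B C" if "u \<le> d_J l A B" for u
    using add_mono[OF that pos(2)] by simp
  have C_le: "u \<le> d_J l A B + d_J l B C" if "u \<le> d_J l B C" for u
    using add_mono[OF pos(1) that] by simp
  show ?thesis
  proof (cases "chron_less l x z")
    case False
    then have "ldist l x z = 0" by (simp add: ldist_eq_0_iff)
    then show ?thesis using pos by simp
  next
    case True
    note xz = chron_imp_causal[OF True]
    show ?thesis
    proof (cases rule: weak_cauchy_cases[OF B, of x])
      case 1
      then show ?thesis using C_le ldist_le_d_J(1)[OF _ z] by blast
    next
      case (2 a)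
      have "ldist l x z \<le> ldist l a z" using ldist_mono(2)[OF chron_imp_causal[OF 2(2)] xz] .
      then show ?thesis using C_le ldist_le_d_J(1)[OF 2(1) z] by (meson order_trans)
    next
      case x: (3 a)
      show ?thesis
      proof (cases rule: weak_cauchy_cases[OF B, of z])
        case 1
        then show ?thesis using A_le ldist_le_d_J(1)[OF assms(4)] by blast
      next
        case (3 a)
        have "ldist l x z \<le> ldist l x a" using ldist_mono(1)[OF xz chron_imp_causal[OF 3(2)]] .
        then show ?thesis using A_le ldist_le_d_J(1)[OF assms(4) 3(1)] by (meson order_trans)
      next
        case (2 b)
        obtain p where p: "p \<in> B" "ldist l x z \<le> ldist l x p + ldist l p z"
          by (rule ldist_split_at_weak_cauchy[OF B xz x 2])
        note p(2)
        also have "ldist l x p + ldist l p z \<le> d_J l A B + d_J l B C"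
          by (intro add_mono ldist_le_d_J(1) assms p)
        finally show ?thesis .
      qed
    qed
  qed
qed

text \<open>Distance zero excludes chronological relations between the two sets, so
  \<open>weak_cauchy_cases\<close> puts each point of one into the other; achronality gives the
  converse. For the triangle inequality both orders of the arguments are bounded separately.\<close>

lemma extended_metric_d_J: "extended_metric_on (weak_cauchy_sets l crv) (d_J l)"
  unfolding extended_metric_on_def
proof (intro conjI ballI)
  fix A B assume A: "A \<in> weak_cauchy_sets l crv" and B: "B \<in> weak_cauchy_sets l crv"
  obtain a b where ab: "a \<in> A" "b \<in> B" using weak_cauchy_nonempty A B by (meson all_not_in_conv)
  show pos: "0 \<le> d_J l A B" using ldist_le_d_J(1)[OF ab] ldist_nonneg order_trans by blast
  show "d_J l A B = d_J l B A" by (rule d_J_commute)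
  show "d_J l A B = 0 \<longleftrightarrow> A = B"
  proof
    assume 0: "d_J l A B = 0"
    have sub: "A \<subseteq> B" if A: "A \<in> weak_cauchy_sets l crv" and B: "B \<in> weak_cauchy_sets l crv"
      and 0: "d_J l A B = 0" for A B
    proof
      fix x assume x: "x \<in> A"
      show "x \<in> B"
      proof (cases rule: weak_cauchy_cases[OF B, of x])
        case (2 a)
        then show ?thesis using ldist_le_d_J(2)[OF x 2(1)] 0 by (simp add: chron_less_def)
      next
        case (3 a)
        then show ?thesis using ldist_le_d_J(1)[OF x 3(1)] 0 by (simp add: chron_less_def)
      qed
    qed
    show "A = B" using sub[OF A B 0] sub[OF B A] 0 d_J_commute[of A B] by simp
  next
    assume AB: "A = B"
    have "ldist l x y = 0" if "x \<in> A" "y \<in> A" for x y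
      using achronal[OF A that] by (simp add: ldist_eq_0_iff)
    then have "d_J l A B \<le> 0" unfolding AB[symmetric] by (intro d_J_le) simp_all
    then show "d_J l A B = 0" using pos by simp
  qed
  fix C assume C: "C \<in> weak_cauchy_sets l crv"
  obtain c where c: "c \<in> C" using weak_cauchy_nonempty C by (meson all_not_in_conv)
  show "d_J l A C \<le> d_J l A B + d_J l B C"
  proof (rule d_J_le)
    show "0 \<le> d_J l A B + d_J l B C" using ldist_le_d_J_add[OF A B C ab(1) c] ldist_nonneg order_trans by blast
    show "ldist l x z \<le> d_J l A B + d_J l B C" if "x \<in> A" "z \<in> C" for x z
      by (rule ldist_le_d_J_add[OF A B C that])
    show "ldist l z x \<le> d_J l A B + d_J l B C" if "x \<in> A" "z \<in> C" for x z
      using ldist_le_d_J_add[OF C B A that(2,1)] by (simp add: d_J_commute[of C B] d_J_commute[of B A] add.commute)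
  qed
qed

section \<open>Completeness\<close>

lemma tendsto_ldist:
  assumes "(f \<longlongrightarrow> a) F" "(g \<longlongrightarrow> b) F"
  shows "((\<lambda>n. ldist l (f n) (g n)) \<longlongrightarrow> ldist l a b) F"
  using continuous_on_tendsto_compose[OF cont[unfolded continuous_ldist_def] tendsto_Pair[OF assms]] by simp

text \<open>If the parameters exceeded every bound in \<open>I\<close>, each later point of the
  curve would precede some \<open>\<gamma> (t n)\<close> and so have distance at most 1 from
  \<open>\<gamma> (t N)\<close>. Cauchy completeness would then provide a greatest parameter in
  \<open>I\<close>, which is a bound after all. The argument towards the past is the same.\<close>

lemma cauchy_complete_traces_bounded:
  fixes A :: "nat \<Rightarrow> 'a set"
  assumes cauchy: "\<forall>\<epsilon>>0. \<exists>N. \<forall>m\<ge>N. \<forall>n\<ge>N. d_J l (A m) (A n) < \<epsilon>"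
    and \<gamma>: "cauchy_complete_timelike l crv I \<gamma>" and t: "\<And>n. t n \<in> I" "\<And>n. \<gamma> (t n) \<in> A n"
  obtains a b N where "a \<in> I" "b \<in> I" "\<And>n. N \<le> n \<Longrightarrow> a \<le> t n \<and> t n \<le> b"
proof -
  obtain N where N: "\<And>m n. N \<le> m \<Longrightarrow> N \<le> n \<Longrightarrow> d_J l (A m) (A n) < ereal 1"
    using cauchy[rule_format, of "ereal 1"] by auto
  have tl: "timelike_curve l crv I \<gamma>" by (rule cauchy_complete_timelike_curve[OF \<gamma>])
  have near: "ldist l (\<gamma> (t m)) (\<gamma> (t n)) < ereal 1" if "N \<le> m" "N \<le> n" for m n
    using ldist_le_d_J(1)[OF t(2) t(2), of m n] N[OF that] by order
  have up: "\<exists>b\<in>I. \<forall>n\<ge>N. t n \<le> b"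
  proof (rule ccontr)
    assume no: "\<not> (\<exists>b\<in>I. \<forall>n\<ge>N. t n \<le> b)"
    have "ldist l (\<gamma> (t N)) (\<gamma> u) \<le> ereal 1" if u: "u \<in> I" "t N \<le> u" for u
    proof -
      obtain n where n: "N \<le> n" "u < t n" using no u by (auto simp: not_le)
      have "ldist l (\<gamma> (t N)) (\<gamma> u) \<le> ldist l (\<gamma> (t N)) (\<gamma> (t n))"
        using u n t by (intro ldist_mono(1) timelike_le[OF tl]) auto
      then show ?thesis using near[OF le_refl n(1)] by order
    qed
    then have "\<exists>m\<in>I. \<forall>t\<in>I. t \<le> m"
      using \<gamma> t(1)[of N] unfolding cauchy_complete_iff future_cauchy_complete_iff by blast
    then show False using no t(1) by blast
  qed
  have lo: "\<exists>a\<in>I. \<forall>n\<ge>N. a \<le> t n"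
  proof (rule ccontr)
    assume no: "\<not> (\<exists>a\<in>I. \<forall>n\<ge>N. a \<le> t n)"
    have "ldist l (\<gamma> u) (\<gamma> (t N)) \<le> ereal 1" if u: "u \<in> I" "u \<le> t N" for u
    proof -
      obtain n where n: "N \<le> n" "t n < u" using no u by (auto simp: not_le)
      have "ldist l (\<gamma> u) (\<gamma> (t N)) \<le> ldist l (\<gamma> (t n)) (\<gamma> (t N))"
        using u n t by (intro ldist_mono(2) timelike_le[OF tl]) auto
      then show ?thesis using near[OF n(1) le_refl] by order
    qed
    then have "\<exists>m\<in>I. \<forall>t\<in>I. m \<le> t"
      using \<gamma> t(1)[of N] unfolding cauchy_complete_iff past_cauchy_complete_iff by blast
    then show False using no t(1) by blast
  qed
  show thesis using up lo that[of _ _ N] by auto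
qed

lemma cauchy_complete_traces_converge:
  fixes A :: "nat \<Rightarrow> 'a set"
  assumes cauchy: "\<forall>\<epsilon>>0. \<exists>N. \<forall>m\<ge>N. \<forall>n\<ge>N. d_J l (A m) (A n) < \<epsilon>"
    and \<gamma>: "cauchy_complete_timelike l crv I \<gamma>" and t: "\<And>n. t n \<in> I" "\<And>n. \<gamma> (t n) \<in> A n"
  obtains s where "s \<in> I" "t \<longlonglongrightarrow> s"
proof -
  have tl: "timelike_curve l crv I \<gamma>" by (rule cauchy_complete_timelike_curve[OF \<gamma>])
  obtain a b M where M: "a \<in> I" "b \<in> I" "\<And>n. M \<le> n \<Longrightarrow> a \<le> t n \<and> t n \<le> b"
    using cauchy_complete_traces_bounded[OF cauchy \<gamma> t] by blast
  have abI: "{a..b} \<subseteq> I"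
    using mem_is_interval_1_I[OF timelike_interval(1)[OF tl] M(1,2)] by auto
  have "Cauchy t"
  proof (rule CauchyI)
    fix e :: real assume e: "0 < e"
    \<comment> \<open>Pairs of parameters at least \<open>e\<close> apart. On this compact set the
      continuous distance has a positive lower bound \<open>\<delta>\<close>, so that sets closer
      than \<open>\<delta>\<close> have traces less than \<open>e\<close> apart.\<close>
    define K where "K = ({a..b} \<times> {a..b}) \<inter> {z. fst z + e \<le> snd z}"
    have K: "compact K" unfolding K_def
      by (intro compact_Int_closed compact_Times compact_Icc closed_Collect_le continuous_intros)
    have "\<exists>\<delta>>0. \<forall>z\<in>K. \<delta> \<le> ldist l (\<gamma> (fst z)) (\<gamma> (snd z))"
    proof (cases "K = {}")
      case True
      then show ?thesis by (intro exI[of _ 1]) simp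
    next
      case False
      have \<gamma>c: "continuous_on {a..b} \<gamma>" using timelike_interval(3)[OF tl] abI continuous_on_subset by blast
      have "continuous_on K (\<lambda>z. (\<gamma> (fst z), \<gamma> (snd z)))"
        by (intro continuous_on_Pair continuous_on_compose2[OF \<gamma>c] continuous_on_fst continuous_on_snd
            continuous_on_id) (auto simp: K_def)
      from continuous_on_compose2[OF cont[unfolded continuous_ldist_def] this]
      have "continuous_on K (\<lambda>z. ldist l (\<gamma> (fst z)) (\<gamma> (snd z)))" by simp
      from continuous_attains_inf[OF K False this]
      obtain z where z: "z \<in> K" "\<forall>w\<in>K. ldist l (\<gamma> (fst z)) (\<gamma> (snd z)) \<le> ldist l (\<gamma> (fst w)) (\<gamma> (snd w))"
        by blast
      have "fst z \<in> I" "snd z \<in> I" "fst z < snd z" using z(1) abI e by (auto simp: K_def)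
      then have "0 < ldist l (\<gamma> (fst z)) (\<gamma> (snd z))"
        using timelike_less[OF tl] by (simp add: chron_less_def)
      then show ?thesis using z(2) by blast
    qed
    then obtain \<delta> where \<delta>: "\<delta> > 0" "\<And>z. z \<in> K \<Longrightarrow> \<delta> \<le> ldist l (\<gamma> (fst z)) (\<gamma> (snd z))" by blast
    obtain N where N: "\<And>m n. N \<le> m \<Longrightarrow> N \<le> n \<Longrightarrow> d_J l (A m) (A n) < \<delta>"
      using cauchy \<delta>(1) by blast
    have lt: "t n < t m + e" if mn: "max M N \<le> m" "max M N \<le> n" for m n
    proof (rule ccontr)
      assume "\<not> t n < t m + e"
      then have "(t m, t n) \<in> K" using M(3)[of m] M(3)[of n] mn by (auto simp: K_def)
      then have "\<delta> \<le> ldist l (\<gamma> (t m)) (\<gamma> (t n))" using \<delta>(2) by fastforce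
      also have "\<dots> \<le> d_J l (A m) (A n)" by (rule ldist_le_d_J(1)[OF t(2) t(2)])
      also have "\<dots> < \<delta>" using N mn by simp
      finally show False by simp
    qed
    have "norm (t m - t n) < e" if "max M N \<le> m" "max M N \<le> n" for m n
      using lt[of m n] lt[of n m] that by (simp add: abs_less_iff)
    then show "\<exists>M. \<forall>m\<ge>M. \<forall>n\<ge>M. norm (t m - t n) < e" by blast
  qed
  then obtain s where s: "t \<longlonglongrightarrow> s" using Cauchy_convergent convergent_def by blast
  \<comment> \<open>The limit stays in \<open>I\<close>, because a compact interval inside
    \<open>I\<close> contains almost all terms.\<close>
  have "eventually (\<lambda>n. t n \<in> {a..b}) sequentially"
    using M(3) by (auto simp: eventually_sequentially)
  then have "s \<in> {a..b}"
    using Lim_in_closed_set[OF closed_atLeastAtMost _ sequentially_bot s] by blast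
  then show thesis using that[of s] s abI by blast
qed

lemma complete_d_J: "complete_extended_metric (weak_cauchy_sets l crv) (d_J l)"
  unfolding complete_extended_metric_def
proof (intro conjI allI impI extended_metric_d_J)
  fix A :: "nat \<Rightarrow> 'a set"
  assume "range A \<subseteq> weak_cauchy_sets l crv \<and> (\<forall>\<epsilon>>0. \<exists>N. \<forall>m\<ge>N. \<forall>n\<ge>N. d_J l (A m) (A n) < \<epsilon>)"
  then have A: "\<And>n. A n \<in> weak_cauchy_sets l crv"
    and cauchy: "\<forall>\<epsilon>>0. \<exists>N. \<forall>m\<ge>N. \<forall>n\<ge>N. d_J l (A m) (A n) < \<epsilon>" by auto
  define B where "B = {y. \<exists>f. (\<forall>n. f n \<in> A n) \<and> f \<longlonglongrightarrow> y}"
  \<comment> \<open>At each index both sequences choose from the same achronal set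
    \<open>A n\<close>, so their distances vanish, and by continuity so does that of the
    limits.\<close>
  have ach: "\<not> chron_less l x y" if xB: "x \<in> B" and yB: "y \<in> B" for x y
  proof -
    obtain f where f: "\<And>n. f n \<in> A n" "f \<longlonglongrightarrow> x" using xB unfolding B_def by blast
    obtain g where g: "\<And>n. g n \<in> A n" "g \<longlonglongrightarrow> y" using yB unfolding B_def by blast
    have "(\<lambda>n. ldist l (f n) (g n)) = (\<lambda>n. 0)"
      using achronal[OF A f(1) g(1)] by (intro ext) (simp add: ldist_eq_0_iff)
    then have "(\<lambda>n. 0) \<longlonglongrightarrow> ldist l x y" using tendsto_ldist[OF f(2) g(2)] by simp
    then have "ldist l x y = 0" using LIMSEQ_unique tendsto_const by blast
    then show ?thesis by (simp add: ldist_eq_0_iff)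
  qed
  have B: "B \<in> weak_cauchy_sets l crv"
    unfolding weak_cauchy_sets_def mem_Collect_eq
  proof (intro allI impI)
    fix I \<gamma> assume \<gamma>: "cauchy_complete_timelike l crv I \<gamma>"
    have tl: "timelike_curve l crv I \<gamma>" by (rule cauchy_complete_timelike_curve[OF \<gamma>])
    have "\<exists>t. t \<in> I \<and> \<gamma> t \<in> A n" for n by (rule weak_cauchy_meets[OF A \<gamma>, of n]) blast
    then obtain t where t: "\<And>n. t n \<in> I" "\<And>n. \<gamma> (t n) \<in> A n" by metis
    \<comment> \<open>The limit of the intersection parameters with the \<open>A n\<close> is an
      intersection parameter with \<open>B\<close>; achronality of \<open>B\<close> makes it the
      only one.\<close>
    obtain s where s: "s \<in> I" "t \<longlonglongrightarrow> s" by (rule cauchy_complete_traces_converge[OF cauchy \<gamma> t])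
    have "(\<lambda>n. \<gamma> (t n)) \<longlonglongrightarrow> \<gamma> s"
      by (rule continuous_on_tendsto_compose[OF timelike_interval(3)[OF tl] s(2,1)]) (simp add: t)
    then have sB: "\<gamma> s \<in> B" using t(2) unfolding B_def by (intro CollectI exI[of _ "\<lambda>n. \<gamma> (t n)"]) simp
    have uniq: "u = s" if u: "u \<in> I" "\<gamma> u \<in> B" for u
    proof (rule ccontr)
      assume "u \<noteq> s"
      then consider "u < s" | "s < u" by linarith
      then show False
        using ach[OF u(2) sB] ach[OF sB u(2)] timelike_less[OF tl, of u s]
          timelike_less[OF tl, of s u] u(1) s(1) by cases simp_all
    qed
    show "\<exists>!t. t \<in> I \<and> \<gamma> t \<in> B"
    proof (rule ex1I)
      show "s \<in> I \<and> \<gamma> s \<in> B" using s(1) sB by (rule conjI)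
      show "u = s" if "u \<in> I \<and> \<gamma> u \<in> B" for u by (rule uniq[OF conjunct1[OF that] conjunct2[OF that]])
    qed
  qed
  have lim: "(\<lambda>n. d_J l (A n) B) \<longlonglongrightarrow> 0"
  proof (rule order_tendstoI)
    fix a :: ereal assume "a < 0"
    moreover have "0 \<le> d_J l (A n) B" for n
      using extended_metric_d_J A B unfolding extended_metric_on_def by blast
    ultimately show "eventually (\<lambda>n. a < d_J l (A n) B) sequentially"
      by (intro always_eventually allI) (meson less_le_trans)
  next
    fix a :: ereal assume "0 < a"
    \<comment> \<open>Passing to the limit preserves only weak inequalities, so the bound is taken
      strictly below \<open>a\<close>.\<close>
    then obtain \<epsilon> where \<epsilon>: "0 < \<epsilon>" "\<epsilon> < a" using dense by blast
    obtain N where N: "\<And>m n. N \<le> m \<Longrightarrow> N \<le> n \<Longrightarrow> d_J l (A m) (A n) < \<epsilon>"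
      using cauchy \<epsilon>(1) by blast
    have "d_J l (A n) B \<le> \<epsilon>" if n: "N \<le> n" for n
    proof (rule d_J_le)
      show "0 \<le> \<epsilon>" using \<epsilon> by simp
      fix x y assume x: "x \<in> A n" and y: "y \<in> B"
      obtain f where f: "\<And>m. f m \<in> A m" "f \<longlonglongrightarrow> y" using y unfolding B_def by blast
      \<comment> \<open>For fixed \<open>n\<close> the bound by \<open>\<epsilon>\<close> holds for
        all late \<open>m\<close>; letting \<open>m\<close> tend to infinity carries it over from
        \<open>f m\<close> to \<open>y\<close>.\<close>
      have le: "ldist l x (f m) \<le> \<epsilon>" "ldist l (f m) x \<le> \<epsilon>" if "N \<le> m" for m
        using ldist_le_d_J[OF x f(1), of m] N[OF n that] by (meson less_imp_le order_trans)+
      show "ldist l x y \<le> \<epsilon>"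
        by (rule tendsto_upperbound[OF tendsto_ldist[OF tendsto_const f(2)] _ sequentially_bot])
          (use le in \<open>auto simp: eventually_sequentially\<close>)
      show "ldist l y x \<le> \<epsilon>"
        by (rule tendsto_upperbound[OF tendsto_ldist[OF f(2) tendsto_const] _ sequentially_bot])
          (use le in \<open>auto simp: eventually_sequentially\<close>)
    qed
    then show "eventually (\<lambda>n. d_J l (A n) B < a) sequentially"
      unfolding eventually_sequentially using \<epsilon>(2) by (intro exI[of _ N]) (meson le_less_trans)
  qed
  show "\<exists>B\<in>weak_cauchy_sets l crv. (\<lambda>n. d_J l (A n) B) \<longlonglongrightarrow> 0" using B lim by (rule rev_bexI)
qed

end

text \<open>Condition B makes the inextendible timelike curves the same as the Cauchy complete ones,
  so both families of sets are tested on the same curves.\<close>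

lemma condition_B_cauchy_sets:
  assumes "condition_B l crv"
  shows "cauchy_sets l crv = weak_cauchy_sets l crv"
proof -
  have "inextendible_timelike l crv I \<gamma> \<longleftrightarrow> cauchy_complete_timelike l crv I \<gamma>" for I \<gamma>
    using assms unfolding condition_B_def cauchy_complete_timelike_def inextendible_timelike_def by metis
  then show ?thesis unfolding cauchy_sets_def weak_cauchy_sets_def by simp
qed

theorem proposition5p15:
  fixes l :: "'a::topological_space \<Rightarrow> 'a \<Rightarrow> ereal"
    and crv :: "real set \<Rightarrow> (real \<Rightarrow> 'a) \<Rightarrow> bool"
  assumes setting:
      "(lorentzian_prelength_space l \<and> first_countable (euclidean :: 'a topology) \<and>
          crv = continuous_curve) \<or>
       (\<exists>\<rho>. KS_prelength_space l \<rho> \<and> metric_compatible l \<rho> \<and> crv = lipschitz_curve \<rho>)"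
    and "timelike_path_connected l crv"
    and "geodesic_space l crv"
    and "causally_simple l"
    and "finite_ldist l"
    and "continuous_ldist l"
    and "compact_diamonds l"
    and "empty_bubbling_boundary l"
  shows "((\<forall>x. \<exists>I \<gamma>. cauchy_complete_timelike l crv I \<gamma> \<and> x \<in> \<gamma> ` I) \<longrightarrow>
            complete_extended_metric (weak_cauchy_sets l crv) (d_J l)) \<and>
         (condition_B l crv \<longrightarrow>
            cauchy_sets l crv = weak_cauchy_sets l crv \<and>
            complete_extended_metric (cauchy_sets l crv) (d_J l))"
proof -
  \<comment> \<open>In the Lipschitz case the condition \<open>mspace \<rho> = UNIV\<close> is part
    of \<open>KS_prelength_space\<close>.\<close>
  have "admissible_curves crv"
    using setting admissible_curves_continuous admissible_curves_lipschitz
    unfolding KS_prelength_space_def by auto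
  then interpret admissible_curves crv .
  have l: "lorentzian_prelength_space l"
    using setting unfolding KS_prelength_space_def by auto
  interpret finite_time_separation crv l
    by unfold_locales (use l assms in \<open>auto simp: lorentzian_prelength_space_def\<close>)
  have complete: "complete_extended_metric (weak_cauchy_sets l crv) (d_J l)"
    if "\<And>x. \<exists>I \<gamma>. cauchy_complete_timelike l crv I \<gamma> \<and> x \<in> \<gamma> ` I"
  proof -
    interpret cauchy_complete_space crv l
      by unfold_locales (use l assms that in \<open>simp_all add: lorentzian_prelength_space_def\<close>)
    show ?thesis by (rule complete_d_J)
  qed
  show ?thesis
  proof (intro conjI impI)
    show "complete_extended_metric (weak_cauchy_sets l crv) (d_J l)"
      if "\<forall>x. \<exists>I \<gamma>. cauchy_complete_timelike l crv I \<gamma> \<and> x \<in> \<gamma> ` I"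
      by (rule complete) (rule that[rule_format])
    assume B: "condition_B l crv"
    then show eq: "cauchy_sets l crv = weak_cauchy_sets l crv" by (rule condition_B_cauchy_sets)
    \<comment> \<open>Condition B supplies the Cauchy complete curves that the first part
      assumes.\<close>
    show "complete_extended_metric (cauchy_sets l crv) (d_J l)"
      unfolding eq by (rule complete, rule condition_B_exists_cauchy_complete[OF assms(2,8) B])
  qed
qed

end
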